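(* Let $f\in\mathbb{Z}[x_1,\dots,x_d]$ have degree $m$. If $f$ is not of the form $c\cdot g(x_1,\dots,x_d)^2$ with $c\in\mathbb{Q}$ and $g\in\mathbb{Q}[x_1,\dots,x_d]$, then there is $B\in\mathbb{Z}$ with $1\le|B|\le H(f)^{O_{d,m}(1)}$ such that for all primes $\ell\nmid B$, \[ \sum_{x_1,\dots,x_d\in\mathbb{Z}/\ell\mathbb{Z}}\left(\frac{f(x_1,\dots,x_d)}{\ell}\right)\ll_{d,m}\ell^{d-1/2}. \]
   Context: $H(f)$ is the height of $f$, i.e. the maximum absolute value of its coefficients; $\left(\frac{\cdot}{\ell}\right)$ is the Legendre (Kronecker) symbol. *)

theory Defs
  imports Complex_Main "HOL-Library.Poly_Mapping" "HOL-Library.FuncSet"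
    "HOL-Number_Theory.Number_Theory"
begin

text \<open>
  Polynomials are finitely supported maps from exponent vectors to coefficients, with the
  convolution product of \<^theory>\<open>HOL-Library.Poly_Mapping\<close>. The variables are
  indexed from \<open>0\<close>, so that \<open>R[x\<^sub>1,\<dots>,x\<^sub>d]\<close> consists of the
  polynomials whose variable indices lie in \<open>{..<d}\<close>.
\<close>

type_synonym 'a mpoly = "(nat \<Rightarrow>\<^sub>0 nat) \<Rightarrow>\<^sub>0 'a"

definition mpoly_ring :: "nat \<Rightarrow> 'a::zero mpoly set" where
  "mpoly_ring d = {p. \<forall>\<mu>\<in>Poly_Mapping.keys p. Poly_Mapping.keys \<mu> \<subseteq> {..<d}}"

definition mpoly_const :: "'a::zero \<Rightarrow> 'a mpoly" where
  "mpoly_const c = Poly_Mapping.single 0 c"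

definition mpoly_eval :: "'a::comm_semiring_1 mpoly \<Rightarrow> (nat \<Rightarrow> 'a) \<Rightarrow> 'a" where
  "mpoly_eval p x = (\<Sum>\<mu>\<in>Poly_Mapping.keys p. Poly_Mapping.lookup p \<mu> *
     (\<Prod>i\<in>Poly_Mapping.keys \<mu>. x i ^ Poly_Mapping.lookup \<mu> i))"

definition mpoly_rat :: "int mpoly \<Rightarrow> rat mpoly" where
  "mpoly_rat f = Poly_Mapping.map of_int f"

definition monom_degree :: "(nat \<Rightarrow>\<^sub>0 nat) \<Rightarrow> nat" where
  "monom_degree \<mu> = (\<Sum>i\<in>Poly_Mapping.keys \<mu>. Poly_Mapping.lookup \<mu> i)"

text \<open>The zero polynomial has total degree \<open>0\<close> and height \<open>0\<close>.\<close>

definition total_degree :: "'a::zero mpoly \<Rightarrow> nat" where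
  "total_degree p = Max (insert 0 (monom_degree ` Poly_Mapping.keys p))"

definition height :: "int mpoly \<Rightarrow> int" where
  "height f = Max (insert 0 ((\<lambda>\<mu>. \<bar>Poly_Mapping.lookup f \<mu>\<bar>) ` Poly_Mapping.keys f))"

text \<open>
  The Kronecker symbol with prime lower argument. At \<open>2\<close> it depends on the upper argument
  modulo \<open>8\<close>, and differs there from \<^const>\<open>Legendre\<close>, which is \<open>1\<close>
  on all odd integers.
\<close>

definition kronecker_prime :: "int \<Rightarrow> nat \<Rightarrow> int" where
  "kronecker_prime a l =
     (if l = 2 then (if even a then 0 else if a mod 8 \<in> {1, 7} then 1 else -1)
      else Legendre a (int l))"

text \<open>
  Residue classes modulo \<open>l\<close> are given by their representatives in \<open>{0..<l}\<close>. The
  choice is immaterial for odd \<open>l\<close>.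
\<close>

definition char_sum :: "nat \<Rightarrow> int mpoly \<Rightarrow> nat \<Rightarrow> int" where
  "char_sum d f l = (\<Sum>x\<in>{..<d} \<rightarrow>\<^sub>E {0..<int l}. kronecker_prime (mpoly_eval f x) l)"

end

theory Submission
  imports Defs "Berlekamp_Zassenhaus.Finite_Field"
begin

text \<open>
  Choose a direction \<open>b\<close> at which the top form of \<open>f\<close> takes a value \<open>a \<noteq> 0\<close> and average over all
  lines \<open>x + tb\<close>. On each of them \<open>f\<close> becomes a polynomial in \<open>t\<close> with leading coefficient \<open>a\<close>, so its
  square root up to a constant is computed by a recursion whose denominators are powers of \<open>2\<close> and \<open>a\<close>.
  In odd degree there is no square root at all, and \<open>B = 2a\<close> works below. In even degree, if \<open>f\<close> is not a
  constant times a square, then some coefficient of this formal square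
  root that should vanish is a nonzero polynomial \<open>\<phi>(x)\<close>. Take \<open>B = 2a\<phi>(y)\<close> for a small integral point
  \<open>y\<close> with \<open>\<phi>(y) \<noteq> 0\<close>. For \<open>l\<close> not dividing \<open>B\<close>, all \<open>x\<close> but \<open>O(l\<^bsup>d-1\<^esup>)\<close> satisfy
  \<open>\<phi>(x) \<noteq> 0\<close> modulo \<open>l\<close>, and for these the sum over the line is \<open>O(\<surd>l)\<close> by Stepanov's method.
\<close>

section \<open>Stepanov's method\<close>

text \<open>The difficulty is uniformity in l: a polynomial that is no constant times a square may
  become one modulo l. Squareness is therefore refuted by an integer. With denominators cleared, the
  coefficients of the formal root are integral polynomial expressions in those of f; they commute
  with reduction, so one nonzero value refutes squareness modulo every prime not dividing it, as
  long as 2a stays invertible. The lines are parallel because a then depends on the direction alone: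
  a single factor 2a of B keeps the degree and permits halving on all of them, and \<phi> is an
  honest polynomial in the base point. On one line an error O(sqrt l) is enough, and auxiliary
  polynomials of high vanishing order supply it by linear algebra and comparison of degrees. The
  points b and y have coordinates bounded in terms of m, which makes B polynomial in H(f). Since the
  bound H(f)^K carries no constant factor, height 1 forces B = 1 or B = -1; the bad primes are then
  bounded in terms of d and m, and the constant C has to absorb them.\<close>

lemma power_dvd_of_higher_pderivs:
  fixes r :: "'a::field poly"
  assumes "\<And>k. k < n \<Longrightarrow> poly ((pderiv ^^ k) r) t = 0"
    and "\<And>k. 0 < k \<Longrightarrow> k < n \<Longrightarrow> of_nat k \<noteq> (0::'a)"
  shows "[:-t, 1:] ^ n dvd r"
  using assms
proof (induction n arbitrary: r)
  case 0
  then show ?case by simp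
next
  case (Suc n)
  show ?case
  proof (cases "r = 0")
    case False
    have IH: "[:-t, 1:] ^ n dvd pderiv r"
    proof (rule Suc.IH)
      fix k assume "k < n"
      then have "poly ((pderiv ^^ Suc k) r) t = 0" by (intro Suc.prems(1)) simp
      then show "poly ((pderiv ^^ k) (pderiv r)) t = 0" by (simp add: funpow_swap1)
    qed (use Suc.prems in auto)
    obtain w where w: "r = [:-t, 1:] ^ order t r * w" "\<not> [:-t, 1:] dvd w"
      using order_decomp[OF False] by blast
    have "poly r t = 0" using Suc.prems(1)[of 0] by simp
    then obtain j where j: "order t r = Suc j"
      using False by (metis order_root not0_implies_Suc)
    have "Suc n \<le> order t r"
    proof (rule ccontr)
      assume *: "\<not> Suc n \<le> order t r"
      \<comment> \<open>\<open>u\<close> is the cofactor of \<open>[:-t, 1:] ^ j\<close> in the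
        derivative. At t it equals (j + 1) w(t), so differentiation lowers the order by exactly one
        as long as j + 1 is nonzero in the field.\<close>
      define u where "u = smult (of_nat (Suc j)) w + [:-t, 1:] * pderiv w"
      have "pderiv r = [:-t, 1:] ^ j * u"
        unfolding u_def by (subst w(1), unfold j, subst pderiv_mult, subst pderiv_power_Suc)
          (simp add: pderiv_pCons algebra_simps)
      then have "[:-t, 1:] ^ Suc j dvd [:-t, 1:] ^ j * u"
        using IH * j by (metis le_imp_power_dvd dvd_trans not_less_eq_eq)
      then have "[:-t, 1:] dvd u"
        unfolding power_Suc2 dvd_mult_cancel_left by auto
      then have "poly u t = 0" by (simp add: poly_eq_0_iff_dvd)
      then have "of_nat (Suc j) * poly w t = 0" unfolding u_def by (simp add: algebra_simps)
      moreover have "poly w t \<noteq> 0" using w(2) by (simp add: poly_eq_0_iff_dvd)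
      moreover have "of_nat (Suc j) \<noteq> (0::'a)" using Suc.prems(2)[of "Suc j"] * j by simp
      ultimately show False by simp
    qed
    then show ?thesis by (meson le_imp_power_dvd order_1 dvd_trans)
  qed simp
qed

lemma card_mult_le_degree:
  fixes r :: "'a::field poly"
  assumes "r \<noteq> 0" "\<And>t. t \<in> S \<Longrightarrow> [:-t, 1:] ^ n dvd r"
  shows "card S * n \<le> degree r"
proof (cases "n = 0 \<or> infinite S")
  case True
  then show ?thesis by auto
next
  case False
  have ord: "n \<le> order t r" if "t \<in> S" for t
    using assms order_divides that by blast
  have sub: "S \<subseteq> set_mset (proots r)"
    using ord False assms(1) by (force simp: order_root)
  have "card S * n = (\<Sum>t\<in>S. n)" by simp
  also have "\<dots> \<le> (\<Sum>t\<in>S. count (proots r) t)"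
    using ord assms(1) by (intro sum_mono) auto
  also have "\<dots> \<le> (\<Sum>t\<in>set_mset (proots r). count (proots r) t)"
    using sub by (intro sum_mono2) auto
  also have "\<dots> = size (proots r)" by (simp add: size_multiset_overloaded_eq)
  also have "\<dots> \<le> degree r" by (rule size_proots_le)
  finally show ?thesis .
qed

text \<open>The cofactor left in the k-th derivative of f^e u after f^(e-k) is taken out, for k at
  most e. Its degree grows with k but not with e; this keeps the number of linear conditions small
  although the power f^h, of degree about pm/2, occurs in the auxiliary polynomial.\<close>

primrec twisted_pderiv :: "'a::idom poly \<Rightarrow> nat \<Rightarrow> nat \<Rightarrow> 'a poly \<Rightarrow> 'a poly" where
  "twisted_pderiv f e 0 u = u"
| "twisted_pderiv f e (Suc k) u =
     of_nat (e - k) * pderiv f * twisted_pderiv f e k u + f * pderiv (twisted_pderiv f e k u)"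

lemma higher_pderiv_twisted:
  fixes f :: "'a::idom poly"
  assumes "k \<le> e"
  shows "(pderiv ^^ k) (f ^ e * u) = f ^ (e - k) * twisted_pderiv f e k u"
  using assms
proof (induction k)
  case (Suc k)
  then obtain i where i: "e - k = Suc i" "e - Suc k = i"
    by (metis Suc_diff_Suc Suc_le_lessD)
  have "(pderiv ^^ Suc k) (f ^ e * u) = pderiv (f ^ Suc i * twisted_pderiv f e k u)"
    using Suc i by simp
  also have "\<dots> = f ^ i * (of_nat (Suc i) * pderiv f * twisted_pderiv f e k u + f * pderiv (twisted_pderiv f e k u))"
    by (subst pderiv_mult, subst pderiv_power_Suc) (simp add: algebra_simps of_nat_poly)
  finally show ?case using i by simp
qed simp

lemma twisted_pderiv_diff:
  "twisted_pderiv f e k (u - v) = twisted_pderiv f e k u - twisted_pderiv f e k v"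
proof (induction k)
  case (Suc k)
  show ?case unfolding twisted_pderiv.simps Suc pderiv_diff by (simp add: algebra_simps)
qed simp

lemma degree_twisted_pderiv:
  fixes f :: "'a::idom poly"
  shows "degree (twisted_pderiv f e k u) \<le> degree u + k * degree f"
proof (induction k)
  case (Suc k)
  let ?w = "twisted_pderiv f e k u"
  have c: "degree (of_nat (e - k) :: 'a poly) = 0" by (simp add: of_nat_poly)
  have "degree (of_nat (e - k) * pderiv f * ?w) \<le> degree (of_nat (e - k) * pderiv f) + degree ?w"
    by (rule degree_mult_le)
  also have "\<dots> \<le> degree f + degree ?w"
    using degree_mult_le[of "of_nat (e - k)" "pderiv f"] degree_pderiv_le[of f] c by linarith
  finally have 1: "degree (of_nat (e - k) * pderiv f * ?w) \<le> degree f + degree ?w" .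
  have 2: "degree (f * pderiv ?w) \<le> degree f + degree ?w"
    using degree_mult_le[of f "pderiv ?w"] degree_pderiv_le[of ?w] by linarith
  show ?case using degree_add_le[OF 1 2] Suc by simp
qed simp

text \<open>In characteristic p the powers of x^p have derivative zero, so they pass through all
  derivations like constants.\<close>

lemma higher_pderiv_const_mult:
  fixes c :: "'a::idom poly"
  assumes "pderiv c = 0"
  shows "(pderiv ^^ k) (w * c) = (pderiv ^^ k) w * c"
  by (induction k) (simp_all add: pderiv_mult assms)

lemma higher_pderiv_add: "(pderiv ^^ k) (u + v) = (pderiv ^^ k) u + (pderiv ^^ k) v"
  by (induction k) (simp_all add: pderiv_add)

lemma higher_pderiv_sum: "(pderiv ^^ k) (sum g A) = (\<Sum>x\<in>A. (pderiv ^^ k) (g x))"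
  by (induction k) (simp_all add: pderiv_sum)

lemma mod_ring_power_card: "(t :: 'a::prime_card mod_ring) ^ CARD('a) = t"
proof (cases "t = 0")
  case True
  then show ?thesis using prime_card[where 'a='a] by (simp add: prime_gt_0_nat)
next
  case False
  define x where "x = nat (to_int_mod_ring t)"
  have r: "to_int_mod_ring t \<in> {0..<int CARD('a)}" using range_to_int_mod_ring[where 'a='a] by blast
  have t: "t = of_nat x" unfolding x_def using r
    by (simp add: of_nat_of_int_mod_ring)
  have nd: "\<not> CARD('a) dvd x"
  proof
    assume "CARD('a) dvd x"
    then have "(of_nat x :: 'a mod_ring) = 0" by (auto elim!: dvdE)
    then show False using False t by simp
  qed
  have "[x ^ (CARD('a) - 1) = 1] (mod CARD('a))" by (rule fermat_theorem[OF prime_card nd])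
  then have "of_nat (x ^ (CARD('a) - 1)) = (of_nat 1 :: 'a mod_ring)"
    by (subst of_nat_eq_iff_cong_CHAR) simp
  then have "t ^ (CARD('a) - 1) = 1" by (simp add: t)
  then have "t ^ Suc (CARD('a) - 1) = t" unfolding power_Suc by (simp only: mult_1_right)
  moreover have "Suc (CARD('a) - 1) = CARD('a)" using nontriv[where 'a='a] by linarith
  ultimately show ?thesis by (rule subst[where P = "\<lambda>i. t ^ i = t", rotated])
qed

text \<open>Isolates the part free of X: with X = x^p this part has degree below p, while the
  identity shows it to be divisible by X.\<close>

lemma square_expansion_identity:
  fixes X :: "'a::comm_ring_1"
  assumes "(r + X * r')\<^sup>2 * f = (s + X * s')\<^sup>2 * (a + X * w)"
  shows "r\<^sup>2 * f - s\<^sup>2 * a = X * (s\<^sup>2 * w + (2 * s * s' + X * s'\<^sup>2) * (a + X * w)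
      - (2 * r * r' + X * r'\<^sup>2) * f)"
  using assms by (simp add: power2_eq_square algebra_simps)

text \<open>Squared and multiplied by \<open>f\<close>, a relation between the \<open>r\<^sub>j\<close> and \<open>s\<^sub>j\<close> becomes a
  polynomial identity modulo \<open>x\<^sup>p\<close>, because \<open>f\<^sup>p \<equiv> f(0)\<close>; by degree it is an honest identity,
  which exhibits \<open>f\<close> as a constant times a square.\<close>

lemma stepanov_independent:
  fixes f :: "'a::prime_card mod_ring poly" and r s :: "nat \<Rightarrow> 'a mod_ring poly"
  defines "p \<equiv> CARD('a)"
  assumes nonsq: "\<not> (\<exists>c h. f = smult c (h\<^sup>2))" and f0: "poly f 0 \<noteq> 0"
    and p: "p = 2 * h + 1"
    and zero: "(\<Sum>j<J. (r j + s j * f ^ h) * monom 1 (j * p)) = 0"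
    and dr: "\<And>j. j < J \<Longrightarrow> 2 * degree (r j) + degree f < p"
    and ds: "\<And>j. j < J \<Longrightarrow> 2 * degree (s j) < p"
    and j: "j < J"
  shows "r j = 0 \<and> s j = 0"
  using j
proof (induction j rule: less_induct)
  case (less k)
  define X :: "'a mod_ring poly" where "X = monom 1 p"
  have Xpow: "monom 1 (i * p) = X ^ i" for i
    unfolding X_def by (simp add: monom_power mult.commute)
  have split: "{..<J} = {..<k} \<union> insert k {Suc k..<J}" using less.prems by auto
  \<comment> \<open>The terms of index below k vanish by induction. \<open>r'\<close> and
    \<open>s'\<close> collect the terms above k, so that X^k can be cancelled and everything beyond
    \<open>r k\<close> and \<open>s k\<close> carries a factor X.\<close>
  define r' where "r' = (\<Sum>j\<in>{Suc k..<J}. r j * X ^ (j - Suc k))"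
  define s' where "s' = (\<Sum>j\<in>{Suc k..<J}. s j * X ^ (j - Suc k))"
  have "0 = (\<Sum>j\<in>insert k {Suc k..<J}. (r j + s j * f ^ h) * X ^ j)"
  proof -
    have "(\<Sum>j<k. (r j + s j * f ^ h) * X ^ j) = 0"
      using less by (intro sum.neutral) auto
    moreover have "(\<Sum>j\<in>{..<k} \<union> insert k {Suc k..<J}. (r j + s j * f ^ h) * X ^ j) =
        (\<Sum>j<k. (r j + s j * f ^ h) * X ^ j) + (\<Sum>j\<in>insert k {Suc k..<J}. (r j + s j * f ^ h) * X ^ j)"
      by (rule sum.union_disjoint) auto
    ultimately show ?thesis
      using zero[unfolded Xpow split] by (simp only: add_0_left)
  qed
  also have "\<dots> = (r k + s k * f ^ h) * X ^ k + (\<Sum>j\<in>{Suc k..<J}. (r j + s j * f ^ h) * X ^ j)"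
    by simp
  also have "(\<Sum>j\<in>{Suc k..<J}. (r j + s j * f ^ h) * X ^ j) =
      (\<Sum>j\<in>{Suc k..<J}. X ^ k * X * (r j * X ^ (j - Suc k) + (s j * X ^ (j - Suc k)) * f ^ h))"
  proof (rule sum.cong[OF refl])
    fix j assume "j \<in> {Suc k..<J}"
    then have "X ^ j = X ^ k * X * X ^ (j - Suc k)"
      unfolding power_Suc2[symmetric] power_add[symmetric] by simp
    then show "(r j + s j * f ^ h) * X ^ j =
       X ^ k * X * (r j * X ^ (j - Suc k) + (s j * X ^ (j - Suc k)) * f ^ h)"
      by (simp add: algebra_simps)
  qed
  also have "\<dots> = X ^ k * X * (r' + s' * f ^ h)"
    unfolding r'_def s'_def sum_distrib_right sum.distrib[symmetric] sum_distrib_left ..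
  also have "(r k + s k * f ^ h) * X ^ k + X ^ k * X * (r' + s' * f ^ h) =
      X ^ k * ((r k + X * r') + (s k + X * s') * f ^ h)"
    by (simp only: algebra_simps)
  finally have "X ^ k * ((r k + X * r') + (s k + X * s') * f ^ h) = 0" by (rule sym)
  moreover have "X ^ k \<noteq> 0" by (simp add: X_def)
  ultimately have "(r k + X * r') + (s k + X * s') * f ^ h = 0"
    by (metis mult_eq_0_iff)
  then have "r k + X * r' = - ((s k + X * s') * f ^ h)" by (simp add: eq_neg_iff_add_eq_0)
  then have "(r k + X * r')\<^sup>2 * f = (s k + X * s')\<^sup>2 * (f ^ h * f ^ h * f)"
    by (simp add: power2_eq_square)
  also have "f ^ h * f ^ h * f = f ^ p" unfolding p by (simp add: power_add mult_2)
  finally have eq: "(r k + X * r')\<^sup>2 * f = (s k + X * s')\<^sup>2 * f ^ p" .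
  obtain a w where aw: "f = pCons a w" by (cases f)
  have fa: "f = [:a:] + [:0, 1:] * w" using aw by simp
  have "f ^ p = [:a:] ^ p + ([:0, 1:] * w) ^ p"
    unfolding fa using freshmans_dream[of p "[:a:]" "[:0,1:] * w"] prime_card[where 'a='a]
    by (simp add: p_def)
  also have "([:0, 1:] * w) ^ p = X * w ^ p"
    unfolding power_mult_distrib X_def monom_altdef by (simp only: smult_1_left)
  also have "[:a:] ^ p = [:a:]"
    using mod_ring_power_card[of a] by (simp add: p_def poly_const_pow)
  finally have fp: "f ^ p = [:a:] + X * w ^ p" .
  have "(r k)\<^sup>2 * f - (s k)\<^sup>2 * [:a:] = X * ((s k)\<^sup>2 * w ^ p + (2 * s k * s' + X * s'\<^sup>2) * ([:a:] + X * w ^ p)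
      - (2 * r k * r' + X * r'\<^sup>2) * f)"
    using eq unfolding fp by (rule square_expansion_identity)
  then have dvd: "X dvd (r k)\<^sup>2 * f - (s k)\<^sup>2 * [:a:]" by simp
  have "degree ((r k)\<^sup>2 * f) < p"
    using degree_mult_le[of "(r k)\<^sup>2" f] degree_power_le[of "r k" 2] dr[OF less.prems] by linarith
  moreover have "degree ((s k)\<^sup>2 * [:a:]) < p"
    using degree_mult_le[of "(s k)\<^sup>2" "[:a:]"] degree_power_le[of "s k" 2] ds[OF less.prems] by simp
  ultimately have "degree ((r k)\<^sup>2 * f - (s k)\<^sup>2 * [:a:]) < p"
    by (rule degree_diff_less)
  moreover have "degree X = p" by (simp add: X_def degree_monom_eq)
  ultimately have "(r k)\<^sup>2 * f - (s k)\<^sup>2 * [:a:] = 0"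
    using dvd by (metis dvd_imp_degree_le linorder_not_less)
  then have id: "(r k)\<^sup>2 * f = smult a ((s k)\<^sup>2)" by simp
  have a: "a \<noteq> 0" using f0 aw by simp
  show ?case
  proof (cases "r k = 0")
    case True
    then show ?thesis using id a by simp
  next
    case False
    have "(r k)\<^sup>2 dvd smult a ((s k)\<^sup>2)" using id by (metis dvd_triv_left)
    then have "(r k)\<^sup>2 dvd (s k)\<^sup>2" using a by (simp add: dvd_smult_iff)
    then have "r k dvd s k" by simp
    then obtain v where "s k = r k * v" by blast
    then have "(r k)\<^sup>2 * f = (r k)\<^sup>2 * smult a (v\<^sup>2)" using id by (simp add: power_mult_distrib)
    then have "f = smult a (v\<^sup>2)" using False
      by (metis mult_left_cancel power_not_zero)
    then show ?thesis using nonsq by blast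
  qed
qed

text \<open>A homogeneous system with more unknowns than equations has a nontrivial solution. Over a
  finite ring this is counting: two coefficient vectors share all values, and their difference is a
  solution because \<Phi> respects differences.\<close>

lemma linear_pigeonhole:
  fixes \<Phi> :: "('i \<Rightarrow> 'a::{finite,comm_ring_1}) \<Rightarrow> 'k \<Rightarrow> 'a"
  assumes fin: "finite I" "finite K" and card: "card K < card I"
    and diff: "\<And>c c' k. k \<in> K \<Longrightarrow> \<Phi> (\<lambda>i. c i - c' i) k = \<Phi> c k - \<Phi> c' k"
  obtains c where "\<exists>i\<in>I. c i \<noteq> 0" "\<And>k. k \<in> K \<Longrightarrow> \<Phi> c k = 0"
proof -
  let ?U = "I \<rightarrow>\<^sub>E (UNIV :: 'a set)" and ?V = "K \<rightarrow>\<^sub>E (UNIV :: 'a set)"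
  let ?F = "\<lambda>c. restrict (\<Phi> c) K"
  have "card {0::'a, 1} \<le> CARD('a)" by (rule card_mono) auto
  then have q: "1 < CARD('a)" by simp
  have "card (?F ` ?U) \<le> card ?V"
    using fin by (intro card_mono finite_PiE) auto
  also have "\<dots> < card ?U"
    using fin card q by (simp add: card_PiE)
  finally have "\<not> inj_on ?F ?U" by (rule pigeonhole)
  then obtain c c' where c: "c \<in> ?U" "c' \<in> ?U" "c \<noteq> c'" "?F c = ?F c'"
    unfolding inj_on_def by blast
  show thesis
  proof (rule that)
    show "\<exists>i\<in>I. c i - c' i \<noteq> 0"
      using c by (metis PiE_ext eq_iff_diff_eq_0)
    fix k assume k: "k \<in> K"
    then have "\<Phi> c k = \<Phi> c' k" using c(4) by (metis restrict_apply')
    then show "\<Phi> (\<lambda>i. c i - c' i) k = 0" using diff[OF k] by simp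
  qed
qed

text \<open>There are 2JD free coefficients, and vanishing to order n at all t with f(t)^h =
  \<epsilon> is imposed through n polynomials of degree below D + nm + J. The inequality
  \<open>count\<close> leaves a nontrivial choice, \<open>stepanov_independent\<close> shows that
  the resulting polynomial is nonzero, and its degree bounds n times the number of such t.\<close>

lemma stepanov_count:
  fixes f :: "'a::prime_card mod_ring poly" and \<epsilon> :: "'a mod_ring"
  defines "p \<equiv> CARD('a)" and "m \<equiv> degree f"
  assumes nonsq: "\<not> (\<exists>c h. f = smult c (h\<^sup>2))" and f0: "poly f 0 \<noteq> 0"
    and p: "p = 2 * h + 1" and D: "2 * D + m \<le> p + 1" and n: "n \<le> p"
    and count: "n * (D + n * m + J) < 2 * J * D"
  shows "card {t. poly f t ^ h = \<epsilon>} * n \<le> D + m * (n + h) + p * J"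
proof -
  \<comment> \<open>The unknowns are indexed by the power of x^p, the exponent below D, and a flag
    that separates the plain block (\<open>True\<close>) from the block multiplied by f^h
    (\<open>False\<close>).\<close>
  define R where "R c b j = (\<Sum>i<D. monom (c (j, i, b)) i)"
    for c :: "nat \<times> nat \<times> bool \<Rightarrow> 'a mod_ring" and b j
  have R_diff: "R (\<lambda>i. c i - c' i) b j = R c b j - R c' b j" for c c' b j
    by (simp add: R_def sum_subtractf[symmetric] diff_monom)
  have D0: "0 < D" using count by (cases D) auto
  have R_deg: "degree (R c b j) \<le> D - 1" for c b j
    unfolding R_def using D0
    by (intro degree_sum_le) (auto intro!: order_trans[OF degree_monom_le])
  have R_coeff: "coeff (R c b j) i = c (j, i, b)" if "i < D" for c b j i
    using that by (simp add: R_def coeff_sum)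
  \<comment> \<open>What the k-th derivative of the auxiliary polynomial becomes at a point with
    f(t)^h = \<epsilon>, up to the factor f(t)^(n-k): there x^(jp) may be replaced by x^j and f^h by
    \<epsilon>. These replacements bring the degree down far enough for the conditions to be
    affordable.\<close>
  define \<sigma> where "\<sigma> c k = (\<Sum>j<J. (twisted_pderiv f n k (R c True j)
      + smult \<epsilon> (twisted_pderiv f (n + h) k (R c False j))) * monom 1 j)" for c k
  have \<sigma>_diff: "\<sigma> (\<lambda>i. c i - c' i) k = \<sigma> c k - \<sigma> c' k" for c c' k
    unfolding \<sigma>_def R_diff twisted_pderiv_diff
    by (simp add: sum_subtractf[symmetric] algebra_simps smult_diff_right)
  have \<sigma>_deg: "degree (\<sigma> c k) < D + n * m + J" if "k < n" for c k
  proof -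
    have "degree (\<sigma> c k) \<le> (D - 1 + n * m) + (J - 1)"
      unfolding \<sigma>_def
    proof (intro degree_sum_le, simp)
      fix j assume j: "j \<in> {..<J}"
      have tw: "degree (twisted_pderiv f e k (R c b j)) \<le> D - 1 + n * m" for e b
      proof -
        have "degree (twisted_pderiv f e k (R c b j)) \<le> degree (R c b j) + k * m"
          unfolding m_def by (rule degree_twisted_pderiv)
        also have "\<dots> \<le> D - 1 + n * m" using R_deg that by (intro add_mono mult_mono) auto
        finally show ?thesis .
      qed
      have "degree (twisted_pderiv f n k (R c True j)
          + smult \<epsilon> (twisted_pderiv f (n + h) k (R c False j))) \<le> D - 1 + n * m"
        by (intro degree_add_le tw order_trans[OF degree_smult_le])
      moreover have "degree (monom (1::'a mod_ring) j) \<le> J - 1"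
        using j degree_monom_le[of "1::'a mod_ring" j] by auto
      ultimately show "degree ((twisted_pderiv f n k (R c True j)
          + smult \<epsilon> (twisted_pderiv f (n + h) k (R c False j))) * monom 1 j)
          \<le> (D - 1 + n * m) + (J - 1)"
        by (intro order_trans[OF degree_mult_le] add_mono)
    qed
    also have "\<dots> < D + n * m + J" using D0 by linarith
    finally show ?thesis .
  qed
  let ?I = "{..<J} \<times> {..<D} \<times> (UNIV :: bool set)" and ?K = "{..<n} \<times> {..<D + n * m + J}"
  obtain c where c: "\<exists>i\<in>?I. c i \<noteq> 0" "\<And>x. x \<in> ?K \<Longrightarrow> (case x of (k, i) \<Rightarrow> coeff (\<sigma> c k) i) = 0"
  proof (rule linear_pigeonhole[of ?I ?K "\<lambda>c (k, i). coeff (\<sigma> c k) i"])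
    show "card ?K < card ?I" using count by (simp add: card_cartesian_product mult_ac)
  qed (auto simp: \<sigma>_diff)
  have \<sigma>0: "\<sigma> c k = 0" if "k < n" for k
  proof (rule poly_eqI)
    fix i show "coeff (\<sigma> c k) i = coeff 0 i"
      using c(2)[of "(k, i)"] \<sigma>_deg[OF that, of c] that
      by (cases "i < D + n * m + J") (auto simp: coeff_eq_0)
  qed
  \<comment> \<open>The common factor f^n leaves at least f^(n-k) after k < n derivations, so the
    formula with \<open>twisted_pderiv\<close> applies to both blocks.\<close>
  define r where "r = (\<Sum>j<J. (f ^ n * R c True j + f ^ (n + h) * R c False j) * monom 1 (j * p))"
  have f_nz: "f \<noteq> 0" using f0 by auto
  have r_nz: "r \<noteq> 0"
  proof
    assume "r = 0"
    then have "f ^ n * (\<Sum>j<J. (R c True j + R c False j * f ^ h) * monom 1 (j * p)) = 0"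
      by (simp add: r_def sum_distrib_left power_add algebra_simps)
    then have "(\<Sum>j<J. (R c True j + R c False j * f ^ h) * monom 1 (j * p)) = 0"
      using f_nz by simp
    then have *: "R c True j = 0 \<and> R c False j = 0" if "j < J" for j
    proof (rule stepanov_independent[OF nonsq f0, folded p_def, OF p])
      fix j
      have d: "2 * (D - 1) + m < p" using D D0 by linarith
      show "2 * degree (R c True j) + degree f < p"
        using R_deg[of c True j] d unfolding m_def by linarith
      show "2 * degree (R c False j) < p"
        using R_deg[of c False j] d by linarith
    qed (use that in auto)
    have "R c b j = 0" if "j < J" for b j using *[OF that] by (cases b) auto
    then show False using c(1) R_coeff by (metis SigmaE coeff_0 lessThan_iff)
  qed
  have "[:-t, 1:] ^ n dvd r" if t: "poly f t ^ h = \<epsilon>" for t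
  proof (rule power_dvd_of_higher_pderivs)
    fix k assume "0 < k" "k < n"
    then have "\<not> p dvd k" using n by (auto dest: dvd_imp_le)
    then show "of_nat k \<noteq> (0 :: 'a mod_ring)" unfolding p_def using of_nat_0_mod_ring_dvd by blast
  next
    fix k assume k: "k < n"
    have const: "pderiv (monom 1 (j * p) :: 'a mod_ring poly) = 0" for j
      by (simp add: pderiv_monom p_def)
    have "(pderiv ^^ k) r = (\<Sum>j<J. (pderiv ^^ k) ((f ^ n * R c True j) * monom 1 (j * p))
        + (pderiv ^^ k) ((f ^ (n + h) * R c False j) * monom 1 (j * p)))"
      unfolding r_def by (simp add: higher_pderiv_sum distrib_right higher_pderiv_add)
    also have "\<dots> = (\<Sum>j<J. (f ^ (n - k) * twisted_pderiv f n k (R c True j)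
        + f ^ (n + h - k) * twisted_pderiv f (n + h) k (R c False j)) * monom 1 (j * p))"
      using k by (intro sum.cong refl)
        (simp add: higher_pderiv_const_mult[OF const] higher_pderiv_twisted distrib_right)
    also have "poly \<dots> t = poly f t ^ (n - k) * poly (\<sigma> c k) t"
    proof -
      have "n + h - k = (n - k) + h" using k by simp
      then have pw: "poly f t ^ (n + h - k) = poly f t ^ (n - k) * \<epsilon>" by (simp add: power_add t)
      have tp: "t ^ (j * p) = t ^ j" for j
        by (simp add: p_def mod_ring_power_card power_mult power_mult[symmetric] mult.commute[of j])
      show ?thesis
        by (simp add: poly_sum \<sigma>_def poly_monom tp pw sum_distrib_left)
          (intro sum.cong refl, simp add: algebra_simps)
    qed
    finally show "poly ((pderiv ^^ k) r) t = 0" using \<sigma>0[OF k] by simp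
  qed
  then have "card {t. poly f t ^ h = \<epsilon>} * n \<le> degree r"
    using r_nz by (intro card_mult_le_degree) auto
  also have "degree r \<le> D + m * (n + h) + p * J"
    unfolding r_def
  proof (intro degree_sum_le, simp)
    fix j assume j: "j \<in> {..<J}"
    have fe: "degree (f ^ e * R c b j) \<le> m * (n + h) + D" if "e \<le> n + h" for e b
    proof -
      have "degree (f ^ e * R c b j) \<le> degree (f ^ e) + degree (R c b j)" by (rule degree_mult_le)
      also have "\<dots> \<le> m * e + (D - 1)"
        using R_deg degree_power_le[of f e] unfolding m_def by (intro add_mono) auto
      also have "\<dots> \<le> m * (n + h) + D" using that by (intro add_mono mult_left_mono) auto
      finally show ?thesis .
    qed
    have "degree (f ^ n * R c True j + f ^ (n + h) * R c False j) \<le> m * (n + h) + D"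
      by (intro degree_add_le fe) auto
    moreover have "degree (monom (1::'a mod_ring) (j * p)) \<le> p * J"
      using j order_trans[OF degree_monom_le[of "1::'a mod_ring" "j * p"]]
      by (simp add: mult.commute)
    ultimately show "degree ((f ^ n * R c True j + f ^ (n + h) * R c False j) * monom 1 (j * p))
        \<le> D + m * (n + h) + p * J"
      using degree_mult_le[of "f ^ n * R c True j + f ^ (n + h) * R c False j"
        "monom 1 (j * p)"] by linarith
  qed
  finally show ?thesis .
qed

text \<open>Take n = 2g with g about sqrt p / 4, D about (p - m)/2 and J = g + m + 1. Compared with
  n/2 = g, the excess m + 1 in J provides 2(m + 1)D surplus unknowns, which pay for the 4g^2 m + 2gJ
  equations not matched by the main term. Division of the degree bound by 2g turns pJ into p/2 +
  O((m + 1) sqrt p).\<close>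

lemma stepanov_bound_aux:
  fixes f :: "'a::prime_card mod_ring poly" and \<epsilon> :: "'a mod_ring"
  defines "p \<equiv> CARD('a)" and "m \<equiv> degree f"
  assumes nonsq: "\<not> (\<exists>c h. f = smult c (h\<^sup>2))" and f0: "poly f 0 \<noteq> 0"
    and p: "p = 2 * h + 1"
  shows "real (card {t. poly f t ^ h = \<epsilon>}) \<le> p / 2 + (7 * real m + 16) * sqrt p"
proof (cases "2 * m + 16 \<le> p")
  case False
  \<comment> \<open>For p < 2m + 16 the trivial count p is already at most (7m + 16) sqrt p; the 16
    in the constant comes from here.\<close>
  have "card {t. poly f t ^ h = \<epsilon>} \<le> CARD('a mod_ring)" by (intro card_mono) auto
  then have "real (card {t. poly f t ^ h = \<epsilon>}) \<le> real p" by (simp add: p_def)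
  also have "\<dots> = real p * 1" by simp
  also have "\<dots> \<le> p * sqrt p" by (intro mult_left_mono) (auto simp: p)
  also have "\<dots> \<le> (7 * real m + 16) * sqrt p" using False by (intro mult_right_mono) auto
  finally show ?thesis by simp
next
  case True
  define g where "g = nat \<lfloor>sqrt p / 4\<rfloor>"
  have sp: "4 \<le> sqrt p" using True real_le_rsqrt[of 4 p] by simp
  have g_le: "real g \<le> sqrt p / 4" and g_gt: "sqrt p / 4 < real g + 1" and g1: "1 \<le> g"
    using sp unfolding g_def by linarith+
  have "(4 * real g)\<^sup>2 \<le> (sqrt p)\<^sup>2" using g_le by (intro power_mono) auto
  then have "real (16 * g * g) \<le> real p" by (simp add: power2_eq_square)
  then have gg: "16 * g * g \<le> p" by (simp only: of_nat_le_iff)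
  then have g16: "16 * g \<le> p" using g1 by (metis le_trans mult_le_mono2 mult.right_neutral)
  define D where "D = (p - m) div 2"
  have D: "2 * D + m \<le> p" "p \<le> 2 * D + m + 1" "p \<le> 4 * D"
    using True unfolding D_def by linarith+
  define J where "J = g + m + 1"
  have "card {t. poly f t ^ h = \<epsilon>} * (2 * g) \<le> D + m * (2 * g + h) + p * J"
  proof (rule stepanov_count[OF nonsq f0, folded p_def m_def, OF p])
    have "16 * g * g * (2 * m + 1) \<le> p * (2 * m + 1)" using gg by (rule mult_right_mono) simp
    moreover have "16 * g * (m + 1) \<le> p * (m + 1)" using g16 by (rule mult_right_mono) simp
    moreover have "p * (4 * (m + 1)) \<le> 4 * D * (4 * (m + 1))" using D(3) by (rule mult_right_mono) simp
    moreover have "p * (2 * m + 1) + p * (m + 1) < p * (4 * (m + 1))"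
      using p by (simp add: algebra_simps)
    ultimately have "16 * g * g * (2 * m + 1) + 16 * g * (m + 1) < 16 * (D * (m + 1))"
      by linarith
    then have "2 * g * g * (2 * m + 1) + 2 * g * (m + 1) < 2 * (D * (m + 1))"
      by (simp add: algebra_simps)
    then show "2 * g * (D + 2 * g * m + J) < 2 * J * D"
      unfolding J_def by (simp add: algebra_simps)
  qed (use D g16 in auto)
  then have "real (card {t. poly f t ^ h = \<epsilon>} * (2 * g)) \<le> real (D + m * (2 * g + h) + p * J)"
    by (simp only: of_nat_le_iff)
  also have "\<dots> = p * g + (D + real m * real h + real p * (real m + 1)) + 2 * g * m"
    unfolding J_def by (simp add: algebra_simps)
  also have "\<dots> \<le> p * g + (p / 2 + real m * (p / 2) + real p * (real m + 1)) + 2 * g * m"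
  proof -
    have "real D \<le> p / 2" "real h \<le> p / 2" using D(1) p by linarith+
    then show ?thesis by (intro add_mono mult_left_mono order_refl) auto
  qed
  also have "\<dots> = p * g + 3 / 2 * (real m + 1) * p + 2 * g * m" by (simp add: field_simps)
  also have "real p = sqrt p * sqrt p" by simp
  \<comment> \<open>From sqrt p / 4 < g + 1 and g at least 1 follows sqrt p at most 8g, so one
    factor sqrt p is traded for a multiple of g, to be cancelled against 2g.\<close>
  also have "3 / 2 * (real m + 1) * (sqrt p * sqrt p) \<le> 3 / 2 * (real m + 1) * ((8 * g) * sqrt p)"
    using g_gt g1 by (intro mult_left_mono mult_right_mono) auto
  finally have "real (card {t. poly f t ^ h = \<epsilon>}) * (2 * g) \<le>
      (p / 2 + 6 * (real m + 1) * sqrt p + m) * (2 * g)"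
    by (simp add: field_simps)
  then have "real (card {t. poly f t ^ h = \<epsilon>}) \<le> p / 2 + 6 * (real m + 1) * sqrt p + m"
    using g1 by simp
  also have "\<dots> \<le> p / 2 + (7 * real m + 16) * sqrt p"
  proof -
    have "real m * 1 \<le> m * sqrt p" using sp by (intro mult_left_mono; linarith)
    then show ?thesis using sp by (simp add: algebra_simps)
  qed
  finally show ?thesis .
qed

text \<open>The independence argument needs f(0) nonzero, as f(0) is the residue of f^p modulo x^p.
  Translation by a point where f does not vanish achieves this and changes neither the count, the
  degree nor the property of being a constant times a square.\<close>

lemma stepanov_bound:
  fixes f :: "'a::prime_card mod_ring poly" and \<epsilon> :: "'a mod_ring"
  defines "p \<equiv> CARD('a)" and "m \<equiv> degree f"
  assumes nonsq: "\<not> (\<exists>c h. f = smult c (h\<^sup>2))"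
    and p: "p = 2 * h + 1" and \<epsilon>: "\<epsilon> \<noteq> 0"
  shows "real (card {t. poly f t ^ h = \<epsilon>}) \<le> p / 2 + (7 * real m + 16) * sqrt p"
proof (cases "\<exists>t0. poly f t0 \<noteq> 0")
  case False
  \<comment> \<open>Excludes 0^0 = 1, which would make every root of f satisfy the equation for
    \<epsilon> = 1.\<close>
  have "h \<noteq> 0" using p nontriv[where 'a='a] by (cases h) (auto simp: p_def)
  then have "{t. poly f t ^ h = \<epsilon>} = {}" using False \<epsilon> by (auto simp: power_0_left)
  then show ?thesis by (simp only: card.empty) simp
next
  case True
  then obtain t0 where t0: "poly f t0 \<noteq> 0" by blast
  define f' where "f' = pcompose f [:t0, 1:]"
  have f_eq: "f = pcompose f' [:-t0, 1:]"
    unfolding f'_def by (simp add: pcompose_assoc[symmetric] pcompose_pCons)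
  have "\<not> (\<exists>c h. f' = smult c (h\<^sup>2))"
  proof
    assume "\<exists>c h. f' = smult c (h\<^sup>2)"
    then obtain c u where "f' = smult c (u\<^sup>2)" by blast
    then have "f = smult c ((pcompose u [:-t0, 1:])\<^sup>2)"
      by (subst f_eq) (simp add: pcompose_smult pcompose_mult power2_eq_square)
    then show False using nonsq by blast
  qed
  moreover have "poly f' 0 \<noteq> 0" using t0 by (simp add: f'_def poly_pcompose)
  ultimately have "real (card {t. poly f' t ^ h = \<epsilon>}) \<le> p / 2 + (7 * real (degree f') + 16) * sqrt p"
    unfolding p_def using p[unfolded p_def] by (rule stepanov_bound_aux)
  moreover have "degree f' = m" by (simp add: f'_def m_def degree_pcompose)
  moreover have "card {t. poly f' t ^ h = \<epsilon>} = card {t. poly f t ^ h = \<epsilon>}"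
    by (rule bij_betw_same_card[of "\<lambda>t. t0 + t"], rule bij_betwI[of _ _ _ "\<lambda>t. t - t0"])
      (auto simp: f'_def poly_pcompose)
  ultimately show ?thesis by simp
qed

text \<open>Upper bounds give lower bounds: all but at most m elements lie in one of the two sets,
  so one count is at least p - m minus the other. The difference is at most 2N - p + m with N the
  larger count, and 15m + 32 = 2(7m + 16) + m.\<close>

lemma euler_count_difference_bound:
  fixes f :: "'a::prime_card mod_ring poly"
  defines "p \<equiv> CARD('a)" and "m \<equiv> degree f"
  assumes nonsq: "\<not> (\<exists>c h. f = smult c (h\<^sup>2))" and p: "p = 2 * h + 1"
  shows "\<bar>real (card {t. poly f t ^ h = 1}) - real (card {t. poly f t ^ h = -1})\<bar>
    \<le> (15 * real m + 32) * sqrt p"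
proof -
  define N where "N \<epsilon> = {t. poly f t ^ h = \<epsilon>}" for \<epsilon>
  have h0: "h \<noteq> 0" using p nontriv[where 'a='a] by (cases h) (auto simp: p_def)
  have f_nz: "f \<noteq> 0" using nonsq by (metis smult_0_left)
  have cover: "N 1 \<union> N (-1) \<union> {t. poly f t = 0} = UNIV"
  proof -
    have "poly f t ^ h = 1 \<or> poly f t ^ h = -1 \<or> poly f t = 0" for t
    proof -
      have "poly f t ^ (2 * h + 1) = poly f t"
        using mod_ring_power_card[of "poly f t"] p by (simp add: p_def)
      then have "poly f t * ((poly f t ^ h)\<^sup>2 - 1) = 0"
        by (simp add: algebra_simps power_mult[symmetric] mult.commute)
      then show ?thesis by (auto simp: power2_eq_1_iff)
    qed
    then show ?thesis by (auto simp: N_def)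
  qed
  have "real p = card (UNIV :: 'a mod_ring set)" by (simp add: p_def)
  also have "\<dots> \<le> real (card (N 1) + card (N (-1)) + card {t. poly f t = 0})"
    unfolding cover[symmetric] of_nat_le_iff
    by (intro order_trans[OF card_Un_le] add_mono order_refl card_Un_le)
  also have "\<dots> \<le> real (card (N 1) + card (N (-1)) + m)"
    using card_poly_roots_bound[OF f_nz] by (simp add: m_def)
  finally have lower: "real p \<le> card (N 1) + card (N (-1)) + real m" by simp
  have upper: "real (card (N \<epsilon>)) \<le> p / 2 + (7 * real m + 16) * sqrt p" if "\<epsilon> \<noteq> 0" for \<epsilon>
    unfolding N_def p_def m_def using stepanov_bound[OF nonsq p[unfolded p_def] that] by simp
  have "1 \<le> sqrt p" by (simp add: p)
  then have "real m * 1 \<le> m * sqrt p" by (intro mult_left_mono) auto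
  then show ?thesis
    using lower upper[of 1] upper[of "-1"] unfolding N_def[symmetric] by (simp add: algebra_simps abs_le_iff)
qed

section \<open>Formal square roots and Legendre sums in one variable\<close>

text \<open>If \<open>q\<^sub>i\<close> and \<open>g\<^sub>i\<close> are the coefficients, counted from the top, of a polynomial and of its
  square root up to a constant, and \<open>a = q\<^sub>0\<close>, then the value at \<open>i > 0\<close> is
  \<open>(4a)\<^sup>i g\<^sub>i / (2 g\<^sub>0)\<close>: the recursion computes the square root with the denominators cleared.\<close>

function sqrt_rec :: "'a::comm_ring_1 \<Rightarrow> (nat \<Rightarrow> 'a) \<Rightarrow> nat \<Rightarrow> 'a" where
  "sqrt_rec a q i = (4 * a) ^ (i - 1) * q i - (\<Sum>j\<in>{1..<i}. sqrt_rec a q j * sqrt_rec a q (i - j))"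
  by auto
termination by (relation "measure (\<lambda>(a, q, i). i)") auto

declare sqrt_rec.simps [simp del]

text \<open>The recursion uses ring operations only. One formula thus serves the residue field, the
  integers and polynomials in the base point, and its values specialise along reduction and
  evaluation.\<close>

lemma sqrt_rec_hom:
  assumes "comm_ring_hom \<phi>"
  shows "\<phi> (sqrt_rec a q i) = sqrt_rec (\<phi> a) (\<lambda>i. \<phi> (q i)) i"
proof (induction i rule: less_induct)
  case (less i)
  interpret comm_ring_hom \<phi> by fact
  show ?case
    by (subst (1 2) sqrt_rec.simps) (simp add: hom_distribs less)
qed

lemma sqrt_rec_cong:
  assumes "\<And>j. j \<le> i \<Longrightarrow> q j = q' j"
  shows "sqrt_rec a q i = sqrt_rec a q' i"
  using assms
proof (induction i rule: less_induct)
  case (less i)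
  then show ?case by (subst (1 2) sqrt_rec.simps) simp
qed

lemma sum_atMost_convolution_split:
  fixes g :: "nat \<Rightarrow> 'a::comm_ring_1"
  assumes "0 < i"
  shows "(\<Sum>j\<le>i. g j * g (i - j)) = 2 * g 0 * g i + (\<Sum>j\<in>{1..<i}. g j * g (i - j))"
proof -
  have "{..i} = insert 0 (insert i {1..<i})" using assms by auto
  then show ?thesis using assms by (simp add: algebra_simps)
qed

text \<open>Compare coefficients in q = c u^2: with v the coefficients of u from the top, q_i = c (2
  v_0 v_i + ...), where the omitted sum involves only v_1, ..., v_(i-1). Multiplying the recursion
  by 4 v_0^2 turns its products into products of terms 2 v_0 y_j, to which induction
  applies.\<close>

lemma sqrt_rec_of_square:
  fixes q u :: "'a::field poly"
  assumes q: "q = smult c (u\<^sup>2)" and a: "a = lead_coeff q" "a \<noteq> 0" and two: "(2::'a) \<noteq> 0" and i: "0 < i"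
  shows "2 * lead_coeff u * sqrt_rec a (coeff (reflect_poly q)) i = (4 * a) ^ i * coeff (reflect_poly u) i"
  using i
proof (induction i rule: less_induct)
  case (less i)
  define v where "v = coeff (reflect_poly u)"
  define y where "y = sqrt_rec a (coeff (reflect_poly q))"
  have v0: "v 0 = lead_coeff u" by (simp add: v_def)
  have ac: "a = c * (v 0)\<^sup>2" unfolding a v0 q by (simp add: lead_coeff_power)
  have v0': "v 0 \<noteq> 0" using ac a by auto
  have "coeff (reflect_poly q) i = c * (\<Sum>j\<le>i. v j * v (i - j))"
    unfolding q v_def by (simp add: reflect_poly_smult power2_eq_square reflect_poly_mult coeff_mult)
  then have qi: "coeff (reflect_poly q) i = c * (2 * v 0 * v i + (\<Sum>j\<in>{1..<i}. v j * v (i - j)))"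
    using sum_atMost_convolution_split[OF less.prems, of v] by simp
  have "4 * (v 0)\<^sup>2 * (\<Sum>j\<in>{1..<i}. y j * y (i - j)) = (\<Sum>j\<in>{1..<i}. (2 * v 0 * y j) * (2 * v 0 * y (i - j)))"
    by (simp add: sum_distrib_left power2_eq_square algebra_simps)
  also have "\<dots> = (\<Sum>j\<in>{1..<i}. (4 * a) ^ i * (v j * v (i - j)))"
  proof (rule sum.cong[OF refl])
    fix j assume j: "j \<in> {1..<i}"
    have "2 * v 0 * y j = (4 * a) ^ j * v j" "2 * v 0 * y (i - j) = (4 * a) ^ (i - j) * v (i - j)"
      using less.IH[of j] less.IH[of "i - j"] j by (auto simp: v0 v_def y_def)
    moreover have "(4 * a) ^ i = (4 * a) ^ j * (4 * a) ^ (i - j)" using j unfolding power_add[symmetric] by simp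
    ultimately show "(2 * v 0 * y j) * (2 * v 0 * y (i - j)) = (4 * a) ^ i * (v j * v (i - j))" by simp
  qed
  also have "\<dots> = (4 * a) ^ i * (\<Sum>j\<in>{1..<i}. v j * v (i - j))" by (simp add: sum_distrib_left)
  finally have S: "4 * (v 0)\<^sup>2 * (\<Sum>j\<in>{1..<i}. y j * y (i - j)) = (4 * a) ^ i * (\<Sum>j\<in>{1..<i}. v j * v (i - j))" .
  \<comment> \<open>One factor 4a is written as 4 v_0^2 c; the c is the one in q_i, and after the
    rewriting the two convolution sums cancel.\<close>
  have pw: "(4 * a) ^ i = (4 * a) ^ (i - 1) * (4 * (v 0)\<^sup>2 * c)"
    using less.prems ac by (cases i) (simp_all add: algebra_simps)
  have "4 * (v 0)\<^sup>2 * y i = 4 * (v 0)\<^sup>2 * ((4 * a) ^ (i - 1) * coeff (reflect_poly q) i)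
      - 4 * (v 0)\<^sup>2 * (\<Sum>j\<in>{1..<i}. y j * y (i - j))"
    unfolding y_def by (subst sqrt_rec.simps) (simp only: right_diff_distrib)
  also have "\<dots> = (4 * a) ^ i * (2 * v 0 * v i)"
    unfolding S unfolding qi pw by (simp only: algebra_simps)
  finally have "(2 * v 0) * (2 * v 0 * y i) = (2 * v 0) * ((4 * a) ^ i * v i)"
    by (simp add: power2_eq_square algebra_simps)
  moreover have "2 * v 0 \<noteq> 0" using v0' two by simp
  ultimately have "2 * v 0 * y i = (4 * a) ^ i * v i" by (simp only: mult_cancel_left) simp
  then show ?case unfolding v0[symmetric] y_def[symmetric] v_def[symmetric] .
qed

text \<open>The root \<open>u\<close> has half the degree of \<open>q\<close>, so counted from the
  top its coefficients end at that index. What survives of the formal root beyond it is an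
  obstruction to being a constant times a square.\<close>

lemma sqrt_rec_square_eq_0:
  fixes q u :: "'a::field poly"
  assumes q: "q = smult c (u\<^sup>2)" "q \<noteq> 0" and two: "(2::'a) \<noteq> 0" and i: "degree q < 2 * i"
  shows "sqrt_rec (lead_coeff q) (coeff (reflect_poly q)) i = 0"
proof -
  have u: "u \<noteq> 0" "c \<noteq> 0" using q by auto
  have "degree q = 2 * degree u" using u by (simp add: q(1) degree_power_eq)
  then have "coeff (reflect_poly u) i = 0" using i by (simp add: coeff_reflect_poly)
  then show ?thesis using sqrt_rec_of_square[OF q(1) refl _ two, of i] q(2) two u i by simp
qed

text \<open>Phrased by integer polynomials and divisibility, without the residue field, so that l is
  an ordinary variable. The middle premise is the certificate of nonsquareness modulo l: odd degree,
  or a formal root coefficient past the middle that l does not divide.\<close>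

definition legendre_sum_bound :: "nat \<Rightarrow> bool" where
  "legendre_sum_bound l \<longleftrightarrow> (\<forall>q::int poly. \<not> int l dvd 2 * lead_coeff q \<longrightarrow>
     odd (degree q) \<or> (\<exists>i\<le>degree q. degree q < 2 * i \<and>
       \<not> int l dvd sqrt_rec (lead_coeff q) (\<lambda>i. coeff q (degree q - i)) i) \<longrightarrow>
     \<bar>real_of_int (\<Sum>t\<in>{0..<int l}. Legendre (poly q t) (int l))\<bar> \<le> (15 * real (degree q) + 32) * sqrt l)"

section \<open>Transfer between integers and the residue field\<close>

lemma of_int_mod_ring_eq_0_iff: "(of_int z :: 'a::prime_card mod_ring) = 0 \<longleftrightarrow> int CARD('a) dvd z"
  using of_int_eq_0_iff_char_dvd[where 'a="'a mod_ring"] by simp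

lemma bij_betw_of_int_mod_ring:
  "bij_betw (of_int :: int \<Rightarrow> 'a::prime_card mod_ring) {0..<int CARD('a)} UNIV"
  unfolding of_int_of_int_mod_ring
proof (rule bij_betwI[of _ _ _ to_int_mod_ring])
  show "to_int_mod_ring \<in> (UNIV :: 'a mod_ring set) \<rightarrow> {0..<int CARD('a)}"
    using range_to_int_mod_ring[where 'a='a] by blast
qed auto

text \<open>Reduction keeps the degree because l does not divide the leading coefficient, and keeps
  the certificate by \<open>sqrt_rec_hom\<close>, so the reduced polynomial is no constant times a
  square. By Euler's criterion the Legendre sum is the difference of the two counts bounded
  before.\<close>

lemma legendre_sum_bound_card: "legendre_sum_bound CARD('a::prime_card)"
  unfolding legendre_sum_bound_def
proof (intro allI impI)
  fix q :: "int poly"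
  define l where "l = CARD('a)"
  let ?m = "degree q"
  assume lead: "\<not> int CARD('a) dvd 2 * lead_coeff q"
    and cert: "odd ?m \<or> (\<exists>i\<le>?m. ?m < 2 * i \<and>
       \<not> int CARD('a) dvd sqrt_rec (lead_coeff q) (\<lambda>i. coeff q (?m - i)) i)"
  have l: "prime l" unfolding l_def by (rule prime_card)
  have l2: "l \<noteq> 2" using lead unfolding l_def by auto
  have l_gt: "2 < l" using l2 prime_ge_2_nat[OF l] by linarith
  then have "odd l" using l by (intro prime_odd_nat)
  then obtain h where h: "l = 2 * h + 1" by (elim oddE)
  define f where "f = map_poly (of_int :: int \<Rightarrow> 'a mod_ring) q"
  have cf: "coeff f i = of_int (coeff q i)" for i by (simp add: f_def coeff_map_poly)
  have lc: "(of_int (lead_coeff q) :: 'a mod_ring) \<noteq> 0" and two: "(2 :: 'a mod_ring) \<noteq> 0"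
    using lead of_int_mod_ring_eq_0_iff[of "lead_coeff q", where 'a='a]
      of_int_mod_ring_eq_0_iff[of 2, where 'a='a] by auto
  have deg: "degree f = ?m"
  proof (rule antisym)
    show "degree f \<le> ?m" unfolding f_def by (rule degree_map_poly_le)
    show "?m \<le> degree f" using lc by (intro le_degree) (simp add: cf)
  qed
  have f_nz: "f \<noteq> 0" using lc cf by (metis coeff_0)
  have pf: "poly f (of_int t) = of_int (poly q t)" for t
    unfolding f_def by simp
  have nonsq: "\<not> (\<exists>c h. f = smult c (h\<^sup>2))"
  proof
    assume "\<exists>c h. f = smult c (h\<^sup>2)"
    then obtain c u where fu: "f = smult c (u\<^sup>2)" by blast
    then have "c \<noteq> 0" using f_nz by auto
    moreover have "u \<noteq> 0" using fu f_nz by auto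
    ultimately have "degree f = 2 * degree u" by (simp add: fu degree_power_eq)
    then have "even ?m" unfolding deg by simp
    then obtain i where i: "i \<le> ?m" "?m < 2 * i"
      "\<not> int CARD('a) dvd sqrt_rec (lead_coeff q) (\<lambda>i. coeff q (?m - i)) i" using cert by blast
    have "sqrt_rec (lead_coeff f) (coeff (reflect_poly f)) i = 0"
      using sqrt_rec_square_eq_0[OF fu f_nz two] i deg by simp
    also have "sqrt_rec (lead_coeff f) (coeff (reflect_poly f)) i =
        sqrt_rec (of_int (lead_coeff q)) (\<lambda>i. of_int (coeff q (?m - i))) i"
      unfolding cf[symmetric] deg
      by (rule sqrt_rec_cong) (use i(1) in \<open>simp add: coeff_reflect_poly deg\<close>)
    also have "\<dots> = of_int (sqrt_rec (lead_coeff q) (\<lambda>i. coeff q (?m - i)) i)"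
      by (rule sqrt_rec_hom[symmetric]) (rule of_int_hom.comm_ring_hom_axioms)
    finally show False using i(3) by (simp only: of_int_mod_ring_eq_0_iff)
  qed
  define \<chi> where "\<chi> t = Legendre (poly q t) (int l)" for t
  have vals: "\<chi> t \<in> {0, 1, -1}" for t unfolding \<chi>_def Legendre_def by auto
  have euler: "of_int (\<chi> t) = poly f (of_int t) ^ h" for t
  proof -
    have "[\<chi> t = poly q t ^ ((l - 1) div 2)] (mod int l)"
      unfolding \<chi>_def using euler_criterion[OF l l_gt] .
    moreover have "(l - 1) div 2 = h" using h by simp
    ultimately have "[\<chi> t = poly q t ^ h] (mod int CHAR('a mod_ring))"
      by (simp only: semiring_char_mod_ring l_def)
    then have "(of_int (\<chi> t) :: 'a mod_ring) = of_int (poly q t ^ h)"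
      by (simp only: of_int_eq_iff_cong_CHAR)
    then show ?thesis by (simp add: pf)
  qed
  \<comment> \<open>As 1 and -1 differ in the field, the residues of 0, 1 and -1 are distinct and a
    value of \<chi> can be read off from its residue.\<close>
  have neq: "(1 :: 'a mod_ring) \<noteq> -1"
    using two by (metis add.right_inverse one_add_one)
  have count: "card {t\<in>{0..<int l}. \<chi> t = e} = card {t. poly f t ^ h = of_int e}" if "e \<in> {1, -1}" for e
  proof -
    have iff: "\<chi> t = e \<longleftrightarrow> poly f (of_int t) ^ h = of_int e" for t
      unfolding euler[symmetric] using vals[of t] that neq neq[symmetric] by auto
    have bij: "bij_betw (of_int :: int \<Rightarrow> 'a mod_ring) {0..<int l} UNIV"
      unfolding l_def by (rule bij_betw_of_int_mod_ring)
    have "{t. poly f t ^ h = of_int e} = of_int ` {t\<in>{0..<int l}. \<chi> t = e}"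
    proof (intro equalityI subsetI)
      fix x assume x: "x \<in> {t. poly f t ^ h = of_int e}"
      obtain t where "t \<in> {0..<int l}" "x = of_int t"
        using bij unfolding bij_betw_def by blast
      then show "x \<in> of_int ` {t\<in>{0..<int l}. \<chi> t = e}" using x iff by blast
    qed (use iff in blast)
    then have "card {t. poly f t ^ h = of_int e} = card (of_int ` {t\<in>{0..<int l}. \<chi> t = e} :: 'a mod_ring set)"
      by (rule arg_cong)
    also have "\<dots> = card {t\<in>{0..<int l}. \<chi> t = e}"
      using bij unfolding bij_betw_def by (intro card_image) (blast intro: inj_on_subset)
    finally show ?thesis ..
  qed
  have "(\<Sum>t\<in>{0..<int l}. \<chi> t) = (\<Sum>t\<in>{0..<int l}. (if \<chi> t = 1 then 1 else 0) - (if \<chi> t = -1 then 1 else 0))"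
  proof (rule sum.cong[OF refl])
    fix t show "\<chi> t = (if \<chi> t = 1 then 1 else 0) - (if \<chi> t = -1 then 1 else 0)"
      using vals[of t] by auto
  qed
  also have "\<dots> = int (card {t\<in>{0..<int l}. \<chi> t = 1}) - int (card {t\<in>{0..<int l}. \<chi> t = -1})"
    by (simp add: sum_subtractf sum.If_cases Int_def)
  finally have "(\<Sum>t\<in>{0..<int l}. \<chi> t) = int (card {t. poly f t ^ h = 1}) - int (card {t. poly f t ^ h = -1})"
    using count[of 1] count[of "-1"] by simp
  then have "real_of_int (\<Sum>t\<in>{0..<int l}. \<chi> t) =
      real (card {t. poly f t ^ h = 1}) - real (card {t. poly f t ^ h = -1})" by (simp only: of_int_diff of_int_of_nat_eq)
  moreover have "\<bar>real (card {t. poly f t ^ h = 1}) - real (card {t. poly f t ^ h = -1})\<bar>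
      \<le> (15 * real (degree f) + 32) * sqrt CARD('a)"
    using nonsq h unfolding l_def by (rule euler_count_difference_bound)
  ultimately show "\<bar>real_of_int (\<Sum>t\<in>{0..<int CARD('a)}. Legendre (poly q t) (int CARD('a)))\<bar>
      \<le> (15 * real ?m + 32) * sqrt CARD('a)"
    unfolding deg l_def \<chi>_def by (simp only:)
qed

text \<open>The field \<open>\<int>/l\<close> is a type only for a fixed modulus. A bound on the type whose cardinality is a
  hypothetical exceptional prime shows that no prime is exceptional.\<close>

definition exceptional_prime :: nat where
  "exceptional_prime = (if \<exists>l. prime l \<and> \<not> legendre_sum_bound l
     then SOME l. prime l \<and> \<not> legendre_sum_bound l else 2)"

lemma prime_exceptional_prime: "prime exceptional_prime"
proof (cases "\<exists>l. prime l \<and> \<not> legendre_sum_bound l")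
  case True
  then show ?thesis using someI_ex[OF True] by (simp add: exceptional_prime_def)
next
  case False
  then show ?thesis by (simp only: exceptional_prime_def if_False two_is_prime_nat)
qed

typedef exceptional_index = "{..<exceptional_prime}"
proof
  show "0 \<in> {..<exceptional_prime}" using prime_gt_0_nat[OF prime_exceptional_prime] by simp
qed

lemma card_exceptional_index: "CARD(exceptional_index) = exceptional_prime"
  by (simp only: type_definition.card[OF type_definition_exceptional_index] card_lessThan)

instance exceptional_index :: prime_card
  by standard (simp only: card_exceptional_index prime_exceptional_prime)

lemma legendre_sum_bound_prime:
  assumes "prime l"
  shows "legendre_sum_bound l"
proof (rule ccontr)
  assume "\<not> legendre_sum_bound l"
  then have ex: "\<exists>l. prime l \<and> \<not> legendre_sum_bound l" using assms by blast
  have "\<not> legendre_sum_bound exceptional_prime"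
    using someI_ex[OF ex] ex by (simp add: exceptional_prime_def)
  then show False
    using legendre_sum_bound_card[where 'a=exceptional_index] by (simp only: card_exceptional_index)
qed

section \<open>Polynomial functions along lines\<close>

text \<open>An integral polynomial function is used only through its restrictions to integral lines,
  which have integer coefficients and bounded degree. This property is stable under sums and
  products, and it yields congruences, small points with nonzero value and the count of zeros modulo
  l.\<close>

definition line_poly_fun :: "nat \<Rightarrow> nat \<Rightarrow> ((nat \<Rightarrow> int) \<Rightarrow> int) \<Rightarrow> bool" where
  "line_poly_fun d D \<phi> \<longleftrightarrow> (\<forall>x y. (\<forall>i<d. x i = y i) \<longrightarrow> \<phi> x = \<phi> y) \<and>
     (\<forall>x v. \<exists>q. degree q \<le> D \<and> (\<forall>t. \<phi> (\<lambda>i. x i + t * v i) = poly q t))"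

lemma line_poly_funI:
  assumes "\<And>x y. (\<And>i. i < d \<Longrightarrow> x i = y i) \<Longrightarrow> \<phi> x = \<phi> y"
    and "\<And>x v. \<exists>q. degree q \<le> D \<and> (\<forall>t. \<phi> (\<lambda>i. x i + t * v i) = poly q t)"
  shows "line_poly_fun d D \<phi>"
  unfolding line_poly_fun_def using assms by blast

lemma line_poly_fun_cong:
  assumes "line_poly_fun d D \<phi>" "\<And>i. i < d \<Longrightarrow> x i = y i"
  shows "\<phi> x = \<phi> y"
  using assms unfolding line_poly_fun_def by blast

lemma line_poly_funE:
  assumes "line_poly_fun d D \<phi>"
  obtains q where "degree q \<le> D" "\<And>t. \<phi> (\<lambda>i. x i + t * v i) = poly q t"
  using assms unfolding line_poly_fun_def by blast

lemma line_poly_fun_mono: "line_poly_fun d D \<phi> \<Longrightarrow> D \<le> D' \<Longrightarrow> line_poly_fun d D' \<phi>"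
  unfolding line_poly_fun_def by (meson order_trans)

lemma line_poly_fun_const: "line_poly_fun d D (\<lambda>_. c)"
proof (rule line_poly_funI)
  show "\<exists>q. degree q \<le> D \<and> (\<forall>t. c = poly q t)" by (rule exI[of _ "[:c:]"]) simp
qed simp

lemma line_poly_fun_coord: "i < d \<Longrightarrow> line_poly_fun d 1 (\<lambda>x. x i)"
proof (rule line_poly_funI)
  fix x v :: "nat \<Rightarrow> int"
  show "\<exists>q. degree q \<le> 1 \<and> (\<forall>t. x i + t * v i = poly q t)"
    by (rule exI[of _ "[:x i, v i:]"]) simp
qed simp

lemma line_poly_fun_add:
  assumes a: "line_poly_fun d D \<phi>" and b: "line_poly_fun d D \<psi>"
  shows "line_poly_fun d D (\<lambda>x. \<phi> x + \<psi> x)"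
proof (rule line_poly_funI)
  fix x v :: "nat \<Rightarrow> int"
  obtain q where q: "degree q \<le> D" "\<And>t. \<phi> (\<lambda>i. x i + t * v i) = poly q t" using line_poly_funE[OF a, where x = x and v = v] by blast
  obtain r where r: "degree r \<le> D" "\<And>t. \<psi> (\<lambda>i. x i + t * v i) = poly r t" using line_poly_funE[OF b, where x = x and v = v] by blast
  show "\<exists>q. degree q \<le> D \<and> (\<forall>t. \<phi> (\<lambda>i. x i + t * v i) + \<psi> (\<lambda>i. x i + t * v i) = poly q t)"
    using q r by (intro exI[of _ "q + r"]) (simp add: degree_add_le)
next
  fix x y :: "nat \<Rightarrow> int" assume "\<And>i. i < d \<Longrightarrow> x i = y i"
  then show "\<phi> x + \<psi> x = \<phi> y + \<psi> y"
    using line_poly_fun_cong[OF a] line_poly_fun_cong[OF b] by metis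
qed

lemma line_poly_fun_mult:
  assumes a: "line_poly_fun d D \<phi>" and b: "line_poly_fun d E \<psi>"
  shows "line_poly_fun d (D + E) (\<lambda>x. \<phi> x * \<psi> x)"
proof (rule line_poly_funI)
  fix x v :: "nat \<Rightarrow> int"
  obtain q where q: "degree q \<le> D" "\<And>t. \<phi> (\<lambda>i. x i + t * v i) = poly q t" using line_poly_funE[OF a, where x = x and v = v] by blast
  obtain r where r: "degree r \<le> E" "\<And>t. \<psi> (\<lambda>i. x i + t * v i) = poly r t" using line_poly_funE[OF b, where x = x and v = v] by blast
  have "degree (q * r) \<le> D + E" using degree_mult_le[of q r] q(1) r(1) by linarith
  then show "\<exists>q. degree q \<le> D + E \<and> (\<forall>t. \<phi> (\<lambda>i. x i + t * v i) * \<psi> (\<lambda>i. x i + t * v i) = poly q t)"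
    using q r by (intro exI[of _ "q * r"]) simp
next
  fix x y :: "nat \<Rightarrow> int" assume "\<And>i. i < d \<Longrightarrow> x i = y i"
  then show "\<phi> x * \<psi> x = \<phi> y * \<psi> y"
    using line_poly_fun_cong[OF a] line_poly_fun_cong[OF b] by metis
qed

lemma line_poly_fun_cmult: "line_poly_fun d D \<phi> \<Longrightarrow> line_poly_fun d D (\<lambda>x. c * \<phi> x)"
  using line_poly_fun_mult[OF line_poly_fun_const[of d 0 c]] by simp

lemma line_poly_fun_diff:
  "line_poly_fun d D \<phi> \<Longrightarrow> line_poly_fun d D \<psi> \<Longrightarrow> line_poly_fun d D (\<lambda>x. \<phi> x - \<psi> x)"
  using line_poly_fun_add[of d D \<phi> "\<lambda>x. (-1) * \<psi> x"] line_poly_fun_cmult[of d D \<psi> "-1"] by simp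

lemma line_poly_fun_sum:
  assumes "\<And>k. k \<in> A \<Longrightarrow> line_poly_fun d D (\<phi> k)"
  shows "line_poly_fun d D (\<lambda>x. \<Sum>k\<in>A. \<phi> k x)"
  using assms
  by (induction A rule: infinite_finite_induct) (simp_all add: line_poly_fun_const line_poly_fun_add)

text \<open>Congruent points lie on an integral line with direction (y - x)/l, at parameters 0 and
  l, where an integral polynomial takes congruent values.\<close>

lemma line_poly_fun_mod:
  assumes \<phi>: "line_poly_fun d D \<phi>" and xy: "\<And>i. i < d \<Longrightarrow> [x i = y i] (mod l)"
  shows "[\<phi> x = \<phi> y] (mod l)"
proof -
  define v where "v i = (y i - x i) div l" for i
  obtain q where q: "\<And>t. \<phi> (\<lambda>i. x i + t * v i) = poly q t" using line_poly_funE[OF \<phi>, where x = x and v = v] by blast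
  have "\<phi> y = \<phi> (\<lambda>i. x i + l * v i)"
  proof (rule line_poly_fun_cong[OF \<phi>])
    fix i assume "i < d"
    then have "l dvd y i - x i" using xy by (metis cong_iff_dvd_diff cong_sym)
    then show "y i = x i + l * v i" by (simp add: v_def)
  qed
  then have y: "\<phi> y = poly q l" using q by simp
  have x: "\<phi> x = poly q 0" using q[of 0] by simp
  show ?thesis unfolding x y by (cases q) (simp add: cong_iff_dvd_diff)
qed

text \<open>The coordinates are made small one at a time: parallel to an axis the restriction is a
  nonzero polynomial of degree at most D and cannot vanish at all D + 1 values 0, ..., D.\<close>

lemma line_poly_fun_grid_nonzero:
  assumes \<phi>: "line_poly_fun d D \<phi>" and y: "\<phi> y \<noteq> 0"
  obtains z where "\<And>i. 0 \<le> z i \<and> z i \<le> int D" "\<phi> z \<noteq> 0"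
proof -
  have "\<exists>z. (\<forall>i<n. 0 \<le> z i \<and> z i \<le> int D) \<and> \<phi> z \<noteq> 0" for n
  proof (induction n)
    case 0
    then show ?case using y by auto
  next
    case (Suc n)
    then obtain z where z: "\<forall>i<n. 0 \<le> z i \<and> z i \<le> int D" "\<phi> z \<noteq> 0" by blast
    define e :: "nat \<Rightarrow> int" where "e i = (if i = n then 1 else 0)" for i
    obtain q where q: "degree q \<le> D" "\<And>t. \<phi> (\<lambda>i. (z(n := 0)) i + t * e i) = poly q t"
      using line_poly_funE[OF \<phi>, where x = "z(n := 0)" and v = e] by blast
    have line: "(\<lambda>i. (z(n := 0)) i + t * e i) = z(n := t)" for t by (auto simp: e_def)
    have "poly q (z n) \<noteq> 0" using q(2)[of "z n"] z(2) unfolding line by simp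
    then have q0: "q \<noteq> 0" by auto
    have "\<exists>t\<in>{0..int D}. poly q t \<noteq> 0"
    proof (rule ccontr)
      assume "\<not> (\<exists>t\<in>{0..int D}. poly q t \<noteq> 0)"
      then have "{0..int D} \<subseteq> {t. poly q t = 0}" by blast
      then have "card {0..int D} \<le> card {t. poly q t = 0}"
        by (intro card_mono poly_roots_finite[OF q0])
      also have "\<dots> \<le> D" using card_poly_roots_bound[OF q0] q(1) by linarith
      finally show False by simp
    qed
    then obtain t where t: "0 \<le> t" "t \<le> int D" "\<phi> (z(n := t)) \<noteq> 0"
      using q(2) unfolding line by auto
    have "\<forall>i<Suc n. 0 \<le> (z(n := t)) i \<and> (z(n := t)) i \<le> int D"
      using z(1) t(1,2) by (simp add: less_Suc_eq)
    then show ?case using t(3) by blast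
  qed
  then obtain z where z: "\<forall>i<d. 0 \<le> z i \<and> z i \<le> int D" "\<phi> z \<noteq> 0" by blast
  \<comment> \<open>Coordinates from d on do not affect \<phi>; set to 0 they satisfy the bound too,
    so it holds without restriction on the index.\<close>
  define w where "w i = (if i < d then z i else 0)" for i
  have "\<phi> w = \<phi> z" by (rule line_poly_fun_cong[OF \<phi>]) (simp add: w_def)
  then show thesis using z by (intro that[of w]) (auto simp: w_def)
qed

text \<open>Lagrange's bound for an integer polynomial. Nonvanishing modulo l is witnessed by a
  value at \<open>s\<close>: this passes to the quotient on splitting off a root, and it is what a
  point on a line provides.\<close>

lemma card_roots_mod_prime:
  fixes q :: "int poly"
  assumes l: "prime l" and s: "\<not> int l dvd poly q s"
  shows "card {t\<in>{0..<int l}. int l dvd poly q t} \<le> degree q"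
  using s
proof (induction "degree q" arbitrary: q)
  case 0
  then obtain c where "q = [:c:]" by (metis degree_eq_zeroE)
  then show ?case using 0 by simp
next
  case (Suc n)
  show ?case
  proof (cases "\<exists>r\<in>{0..<int l}. int l dvd poly q r")
    case False
    then have "{t\<in>{0..<int l}. int l dvd poly q t} = {}" by blast
    then show ?thesis by (simp only: card.empty)
  next
    case True
    then obtain r where r: "r \<in> {0..<int l}" "int l dvd poly q r" by blast
    define w where "w = synthetic_div q r"
    have "poly q t = poly ([:-r, 1:] * w + [:poly q r:]) t" for t
      unfolding w_def by (simp only: synthetic_div_correct')
    then have pq: "poly q t = (t - r) * poly w t + poly q r" for t
      by (simp add: algebra_simps)
    have deg: "n = degree w" using Suc(2) by (simp add: w_def degree_synthetic_div)
    have "\<not> int l dvd poly w s" using Suc(3) pq[of s] r(2) by (metis dvd_add dvd_mult)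
    note IH = Suc(1)[OF deg this]
    have "{t\<in>{0..<int l}. int l dvd poly q t} \<subseteq> insert r {t\<in>{0..<int l}. int l dvd poly w t}"
    proof
      fix t assume t: "t \<in> {t\<in>{0..<int l}. int l dvd poly q t}"
      then have "int l dvd (t - r) * poly w t" using pq[of t] r(2) by (simp add: dvd_add_left_iff)
      then have "int l dvd t - r \<or> int l dvd poly w t" using l by (simp add: prime_dvd_mult_iff)
      moreover have "t = r" if "int l dvd t - r"
      proof -
        have "t mod int l = r mod int l" using that by (simp add: mod_eq_dvd_iff)
        then show ?thesis using t r(1) by simp
      qed
      ultimately show "t \<in> insert r {t\<in>{0..<int l}. int l dvd poly w t}" using t by blast
    qed
    then have "card {t\<in>{0..<int l}. int l dvd poly q t} \<le> card (insert r {t\<in>{0..<int l}. int l dvd poly w t})"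
      by (intro card_mono finite.insertI finite_subset[OF Collect_subset finite_atLeastLessThan_int])
    also have "\<dots> \<le> Suc (card {t\<in>{0..<int l}. int l dvd poly w t})"
      by (rule card_insert_le_m1) (simp_all only: diff_Suc_1 zero_less_Suc order_refl)
    also have "\<dots> \<le> degree q" using IH Suc(2) deg by linarith
    finally show ?thesis .
  qed
qed

section \<open>Averaging over residue boxes\<close>

abbreviation residue_box :: "nat \<Rightarrow> nat \<Rightarrow> (nat \<Rightarrow> int) set" where
  "residue_box d l \<equiv> {..<d} \<rightarrow>\<^sub>E {0..<int l}"

lemma finite_residue_box: "finite (residue_box d l)"
  by (intro finite_PiE) auto

lemma card_residue_box: "card (residue_box d l) = l ^ d"
  by (simp add: card_PiE)

text \<open>An affine map with invertible slope permutes the residues in each coordinate. The case s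
  = 1 averages over parallel lines; fixed c and varying s sweep out the lines through c.\<close>

lemma sum_residue_box_affine:
  fixes \<psi> :: "(nat \<Rightarrow> int) \<Rightarrow> 'b::comm_monoid_add"
  assumes \<psi>: "\<And>x y. (\<And>i. i < d \<Longrightarrow> [x i = y i] (mod int l)) \<Longrightarrow> \<psi> x = \<psi> y"
    and s: "coprime s (int l)" and l: "0 < l"
  shows "(\<Sum>x\<in>residue_box d l. \<psi> (\<lambda>i. c i + s * x i)) = (\<Sum>x\<in>residue_box d l. \<psi> x)"
proof -
  define T where "T x = restrict (\<lambda>i. (c i + s * x i) mod int l) {..<d}" for x :: "nat \<Rightarrow> int"
  have into: "T ` residue_box d l \<subseteq> residue_box d l"
    unfolding T_def by (intro image_subsetI, unfold restrict_PiE_iff) (use l in simp)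
  have inj: "inj_on T (residue_box d l)"
  proof (rule inj_onI)
    fix x y assume x: "x \<in> residue_box d l" and y: "y \<in> residue_box d l" and T: "T x = T y"
    show "x = y"
    proof (rule PiE_ext[OF x y])
      fix i assume i: "i \<in> {..<d}"
      then have "[c i + s * x i = c i + s * y i] (mod int l)"
        using fun_cong[OF T, of i] by (simp add: T_def cong_def)
      then have "[s * x i = s * y i] (mod int l)" by (simp add: cong_add_lcancel)
      then have "[x i = y i] (mod int l)" using s by (simp add: cong_mult_lcancel)
      moreover have "x i \<in> {0..<int l}" "y i \<in> {0..<int l}" 
        by (rule PiE_mem[OF x i], rule PiE_mem[OF y i])
      ultimately show "x i = y i" by (simp add: cong_def)
    qed
  qed
  have bij: "bij_betw T (residue_box d l) (residue_box d l)"
    unfolding bij_betw_def using inj endo_inj_surj[OF finite_residue_box into inj] by blast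
  have "(\<Sum>x\<in>residue_box d l. \<psi> (\<lambda>i. c i + s * x i)) = (\<Sum>x\<in>residue_box d l. \<psi> (T x))"
    by (intro sum.cong refl \<psi>) (simp add: T_def cong_def)
  also have "\<dots> = (\<Sum>x\<in>residue_box d l. \<psi> x)" using bij by (rule sum.reindex_bij_betw)
  finally show ?thesis .
qed

text \<open>A Schwartz--Zippel bound: each line through a point where \<open>\<phi>\<close> does not vanish contains at most
  \<open>D\<close> zeros.\<close>

lemma card_zeros_mod_prime:
  assumes \<phi>: "line_poly_fun d D \<phi>" and l: "prime l" and y: "\<not> int l dvd \<phi> y"
  shows "(l - 1) * card {x\<in>residue_box d l. int l dvd \<phi> x} \<le> D * l ^ d"
proof -
  define \<psi> where "\<psi> x = (if int l dvd \<phi> x then 1 else 0 :: nat)" for x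
  have \<psi>_cong: "\<psi> x = \<psi> y" if "\<And>i. i < d \<Longrightarrow> [x i = y i] (mod int l)" for x y
  proof -
    have "[\<phi> x = \<phi> y] (mod int l)" using \<phi> that by (rule line_poly_fun_mod)
    then show ?thesis by (simp add: \<psi>_def cong_dvd_iff)
  qed
  have l0: "0 < l" using l by (rule prime_gt_0_nat)
  have nl: "nat (int l - 1) = l - Suc 0" by linarith
  have "(l - 1) * card {x\<in>residue_box d l. int l dvd \<phi> x} =
      (\<Sum>t\<in>{1..<int l}. \<Sum>x\<in>residue_box d l. \<psi> x)"
    unfolding \<psi>_def by (simp add: sum.If_cases Int_def finite_residue_box nl)
  \<comment> \<open>The parameter t = 0 is left out because the dilation would degenerate there;
    hence the factor l - 1 in place of l.\<close>
  also have "\<dots> = (\<Sum>t\<in>{1..<int l}. \<Sum>x\<in>residue_box d l. \<psi> (\<lambda>i. y i + t * x i))"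
  proof (rule sum.cong[OF refl])
    fix t assume "t \<in> {1..<int l}"
    then have "\<not> int l dvd t" by (auto dest: zdvd_imp_le)
    then have "coprime (int l) t" using l by (intro prime_imp_coprime) auto
    then have cop: "coprime t (int l)" by (rule coprime_commute[THEN iffD1])
    show "(\<Sum>x\<in>residue_box d l. \<psi> x) = (\<Sum>x\<in>residue_box d l. \<psi> (\<lambda>i. y i + t * x i))"
      using \<psi>_cong cop l0 by (rule sum_residue_box_affine[symmetric])
  qed
  \<comment> \<open>After the exchange x is a direction and t runs along the line through y. At t =
    0 lies y itself, the witness required by \<open>card_roots_mod_prime\<close>.\<close>
  also have "\<dots> = (\<Sum>x\<in>residue_box d l. \<Sum>t\<in>{1..<int l}. \<psi> (\<lambda>i. y i + t * x i))"
    by (rule sum.swap)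
  also have "\<dots> \<le> (\<Sum>x\<in>residue_box d l. D)"
  proof (rule sum_mono)
    fix x
    obtain q where q: "degree q \<le> D" "\<And>t. \<phi> (\<lambda>i. y i + t * x i) = poly q t"
      using line_poly_funE[OF \<phi>, where x = y and v = x] by blast
    have "\<not> int l dvd poly q 0" using y q(2)[of 0] by simp
    from card_roots_mod_prime[OF l this] have *: "card {t\<in>{0..<int l}. int l dvd poly q t} \<le> D" using q(1) by simp
    have "(\<Sum>t\<in>{1..<int l}. \<psi> (\<lambda>i. y i + t * x i)) = card {t\<in>{1..<int l}. int l dvd poly q t}"
      unfolding \<psi>_def q(2) by (simp add: sum.If_cases Int_def)
    also have "\<dots> \<le> card {t\<in>{0..<int l}. int l dvd poly q t}"
      by (intro card_mono finite_subset[OF Collect_subset finite_atLeastLessThan_int]) auto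
    finally show "(\<Sum>t\<in>{1..<int l}. \<psi> (\<lambda>i. y i + t * x i)) \<le> D" using * by simp
  qed
  also have "\<dots> = D * l ^ d" by (simp add: card_residue_box)
  finally show ?thesis .
qed

section \<open>Evaluation of multivariate polynomials\<close>

abbreviation monom_eval :: "(nat \<Rightarrow>\<^sub>0 nat) \<Rightarrow> (nat \<Rightarrow> 'a::comm_semiring_1) \<Rightarrow> 'a" where
  "monom_eval \<mu> x \<equiv> \<Prod>i\<in>Poly_Mapping.keys \<mu>. x i ^ Poly_Mapping.lookup \<mu> i"

lemma monom_eval_superset:
  assumes "finite A" "Poly_Mapping.keys \<mu> \<subseteq> A"
  shows "monom_eval \<mu> x = (\<Prod>i\<in>A. x i ^ Poly_Mapping.lookup \<mu> i)"
  by (rule prod.mono_neutral_left[OF assms]) (simp add: in_keys_iff)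

lemma monom_eval_add: "monom_eval (\<mu> + \<nu>) x = monom_eval \<mu> x * monom_eval \<nu> x"
proof -
  let ?A = "Poly_Mapping.keys \<mu> \<union> Poly_Mapping.keys \<nu>"
  have "monom_eval (\<mu> + \<nu>) x = (\<Prod>i\<in>?A. x i ^ Poly_Mapping.lookup (\<mu> + \<nu>) i)"
    by (rule monom_eval_superset) (simp_all add: keys_add)
  also have "\<dots> = (\<Prod>i\<in>?A. x i ^ Poly_Mapping.lookup \<mu> i) * (\<Prod>i\<in>?A. x i ^ Poly_Mapping.lookup \<nu> i)"
    by (simp add: lookup_add power_add prod.distrib)
  also have "(\<Prod>i\<in>?A. x i ^ Poly_Mapping.lookup \<mu> i) = monom_eval \<mu> x"
    by (rule monom_eval_superset[symmetric]) auto
  also have "(\<Prod>i\<in>?A. x i ^ Poly_Mapping.lookup \<nu> i) = monom_eval \<nu> x"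
    by (rule monom_eval_superset[symmetric]) auto
  finally show ?thesis .
qed

lemma mpoly_eval_superset:
  assumes "finite A" "Poly_Mapping.keys p \<subseteq> A"
  shows "mpoly_eval p x = (\<Sum>\<mu>\<in>A. Poly_Mapping.lookup p \<mu> * monom_eval \<mu> x)"
  unfolding mpoly_eval_def by (rule sum.mono_neutral_left[OF assms]) (simp add: in_keys_iff)

lemma mpoly_eval_add: "mpoly_eval (p + q) x = mpoly_eval p x + mpoly_eval q x"
proof -
  let ?A = "Poly_Mapping.keys p \<union> Poly_Mapping.keys q"
  have "mpoly_eval (p + q) x = (\<Sum>\<mu>\<in>?A. Poly_Mapping.lookup (p + q) \<mu> * monom_eval \<mu> x)"
    by (rule mpoly_eval_superset) (simp_all add: keys_add)
  also have "\<dots> = (\<Sum>\<mu>\<in>?A. Poly_Mapping.lookup p \<mu> * monom_eval \<mu> x)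
      + (\<Sum>\<mu>\<in>?A. Poly_Mapping.lookup q \<mu> * monom_eval \<mu> x)"
    by (simp add: lookup_add distrib_right sum.distrib)
  also have "(\<Sum>\<mu>\<in>?A. Poly_Mapping.lookup p \<mu> * monom_eval \<mu> x) = mpoly_eval p x"
    by (rule mpoly_eval_superset[symmetric]) auto
  also have "(\<Sum>\<mu>\<in>?A. Poly_Mapping.lookup q \<mu> * monom_eval \<mu> x) = mpoly_eval q x"
    by (rule mpoly_eval_superset[symmetric]) auto
  finally show ?thesis .
qed

lemma mpoly_eval_single: "mpoly_eval (Poly_Mapping.single \<mu> c) x = c * monom_eval \<mu> x"
  by (subst mpoly_eval_superset[of "{\<mu>}"]) auto

lemma mpoly_eval_0: "mpoly_eval 0 x = 0"
  by (simp add: mpoly_eval_def)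

lemma mpoly_eval_sum: "mpoly_eval (\<Sum>k\<in>A. g k) x = (\<Sum>k\<in>A. mpoly_eval (g k) x)"
  by (induction A rule: infinite_finite_induct) (simp_all add: mpoly_eval_0 mpoly_eval_add)

lemma poly_mapping_sum_singles:
  fixes p :: "'k \<Rightarrow>\<^sub>0 'a::comm_monoid_add"
  shows "(\<Sum>\<mu>\<in>Poly_Mapping.keys p. Poly_Mapping.single \<mu> (Poly_Mapping.lookup p \<mu>)) = p"
proof (rule poly_mapping_eqI)
  fix \<nu>
  show "Poly_Mapping.lookup (\<Sum>\<mu>\<in>Poly_Mapping.keys p. Poly_Mapping.single \<mu> (Poly_Mapping.lookup p \<mu>)) \<nu>
      = Poly_Mapping.lookup p \<nu>"
    by (simp add: lookup_sum lookup_single when_def in_keys_iff sum.delta)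
qed

lemma mpoly_eval_mult:
  fixes p q :: "'a::comm_semiring_1 mpoly"
  shows "mpoly_eval (p * q) x = mpoly_eval p x * mpoly_eval q x"
proof -
  let ?s = "\<lambda>p \<mu>. Poly_Mapping.single \<mu> (Poly_Mapping.lookup p \<mu>)"
  have "p * q = (\<Sum>\<mu>\<in>Poly_Mapping.keys p. ?s p \<mu>) * (\<Sum>\<nu>\<in>Poly_Mapping.keys q. ?s q \<nu>)"
    by (simp only: poly_mapping_sum_singles)
  also have "\<dots> = (\<Sum>\<mu>\<in>Poly_Mapping.keys p. \<Sum>\<nu>\<in>Poly_Mapping.keys q.
      Poly_Mapping.single (\<mu> + \<nu>) (Poly_Mapping.lookup p \<mu> * Poly_Mapping.lookup q \<nu>))"
    by (simp only: sum_product mult_single)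
  finally have "mpoly_eval (p * q) x = (\<Sum>\<mu>\<in>Poly_Mapping.keys p. \<Sum>\<nu>\<in>Poly_Mapping.keys q.
      (Poly_Mapping.lookup p \<mu> * monom_eval \<mu> x) * (Poly_Mapping.lookup q \<nu> * monom_eval \<nu> x))"
    by (simp only: mpoly_eval_sum mpoly_eval_single monom_eval_add mult_ac)
  also have "\<dots> = mpoly_eval p x * mpoly_eval q x"
    unfolding mpoly_eval_def by (simp only: sum_product)
  finally show ?thesis .
qed

lemma comm_ring_hom_mpoly_eval: "comm_ring_hom (\<lambda>p :: 'a::comm_ring_1 mpoly. mpoly_eval p x)"
proof
  show "mpoly_eval 1 x = 1"
    using mpoly_eval_single[of 0 1 x] by simp
qed (simp_all add: mpoly_eval_add mpoly_eval_mult mpoly_eval_0)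

section \<open>Closure properties of the ring in d variables\<close>

lemma mpoly_ring_add: "p \<in> mpoly_ring d \<Longrightarrow> q \<in> mpoly_ring d \<Longrightarrow> p + q \<in> mpoly_ring d"
  unfolding mpoly_ring_def using keys_add[of p q] by blast

lemma mpoly_ring_diff:
  fixes p q :: "'a::ab_group_add mpoly"
  assumes "p \<in> mpoly_ring d" "q \<in> mpoly_ring d"
  shows "p - q \<in> mpoly_ring d"
proof -
  have "Poly_Mapping.keys (p - q) \<subseteq> Poly_Mapping.keys p \<union> Poly_Mapping.keys q"
    by (rule keys_diff)
  then show ?thesis using assms unfolding mpoly_ring_def by blast
qed

lemma mpoly_ring_single: "Poly_Mapping.keys \<mu> \<subseteq> {..<d} \<Longrightarrow> Poly_Mapping.single \<mu> c \<in> mpoly_ring d"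
  by (auto simp: mpoly_ring_def)

lemma mpoly_ring_0: "0 \<in> mpoly_ring d"
  by (simp add: mpoly_ring_def)

lemma mpoly_ring_of_int: "(of_int c :: 'a::comm_ring_1 mpoly) \<in> mpoly_ring d"
  unfolding single_of_int[symmetric] by (rule mpoly_ring_single) simp

lemma mpoly_ring_mult:
  fixes p q :: "'a::comm_semiring_1 mpoly"
  assumes "p \<in> mpoly_ring d" "q \<in> mpoly_ring d"
  shows "p * q \<in> mpoly_ring d"
  unfolding mpoly_ring_def
proof (intro CollectI ballI)
  fix \<mu> assume "\<mu> \<in> Poly_Mapping.keys (p * q)"
  then obtain \<alpha> \<beta> where "\<mu> = \<alpha> + \<beta>" "\<alpha> \<in> Poly_Mapping.keys p" "\<beta> \<in> Poly_Mapping.keys q"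
    using keys_mult[of p q] by blast
  then show "Poly_Mapping.keys \<mu> \<subseteq> {..<d}"
    using assms keys_add[of \<alpha> \<beta>] unfolding mpoly_ring_def by blast
qed

lemma mpoly_ring_sum: "(\<And>k. k \<in> A \<Longrightarrow> g k \<in> mpoly_ring d) \<Longrightarrow> (\<Sum>k\<in>A. g k) \<in> mpoly_ring d"
  by (induction A rule: infinite_finite_induct) (simp_all add: mpoly_ring_0 mpoly_ring_add)

lemma base_expansion_inj:
  fixes a b :: "nat \<Rightarrow> nat"
  assumes "\<And>i. i < d \<Longrightarrow> a i < N" "\<And>i. i < d \<Longrightarrow> b i < N"
    and "(\<Sum>i<d. a i * N ^ i) = (\<Sum>i<d. b i * N ^ i)" and "i < d"
  shows "a i = b i"
  using assms
proof (induction d arbitrary: a b i)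
  case (Suc d)
  have split: "(\<Sum>i<Suc d. c i * N ^ i) = c 0 + N * (\<Sum>i<d. c (Suc i) * N ^ i)" for c :: "nat \<Rightarrow> nat"
    by (subst sum.lessThan_Suc_shift) (simp add: sum_distrib_left mult_ac)
  have eq: "a 0 + N * (\<Sum>i<d. a (Suc i) * N ^ i) = b 0 + N * (\<Sum>i<d. b (Suc i) * N ^ i)"
    using Suc.prems(3) unfolding split .
  have lt: "a 0 < N" "b 0 < N" using Suc.prems by auto
  have "(a 0 + N * (\<Sum>i<d. a (Suc i) * N ^ i)) mod N = (b 0 + N * (\<Sum>i<d. b (Suc i) * N ^ i)) mod N"
    using eq by simp
  then have zero: "a 0 = b 0" using lt by simp
  then have "(\<Sum>i<d. a (Suc i) * N ^ i) = (\<Sum>i<d. b (Suc i) * N ^ i)" using eq lt by simp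
  then have "a (Suc j) = b (Suc j)" if "j < d" for j
    using that Suc.prems(1,2) by (intro Suc.IH[of "\<lambda>i. a (Suc i)" "\<lambda>i. b (Suc i)"]) auto
  then show ?case using zero Suc.prems(4) by (cases i) auto
qed simp

text \<open>Kronecker substitution \<open>x\<^sub>i = T\<^bsup>N^i\<^esup>\<close> turns distinct monomials into distinct powers of \<open>T\<close>.\<close>

lemma exists_nonzero_value:
  fixes c :: "(nat \<Rightarrow>\<^sub>0 nat) \<Rightarrow> 'a::{idom,ring_char_0}"
  assumes A: "finite A" "\<And>\<mu>. \<mu> \<in> A \<Longrightarrow> Poly_Mapping.keys \<mu> \<subseteq> {..<d}"
    and \<mu>: "\<mu> \<in> A" "c \<mu> \<noteq> 0"
  obtains y :: "nat \<Rightarrow> int" where "(\<Sum>\<mu>\<in>A. c \<mu> * monom_eval \<mu> (\<lambda>i. of_int (y i))) \<noteq> 0"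
proof -
  \<comment> \<open>A base larger than every exponent that occurs, so that the exponents become
    digits.\<close>
  define N where "N = Suc (\<Sum>\<mu>\<in>A. \<Sum>i<d. Poly_Mapping.lookup \<mu> i)"
  have N: "Poly_Mapping.lookup \<nu> i < N" if "\<nu> \<in> A" "i < d" for \<nu> i
  proof -
    have "Poly_Mapping.lookup \<nu> i \<le> (\<Sum>i<d. Poly_Mapping.lookup \<nu> i)"
      using that by (intro member_le_sum) auto
    also have "\<dots> \<le> (\<Sum>\<mu>\<in>A. \<Sum>i<d. Poly_Mapping.lookup \<mu> i)"
      using that A by (intro member_le_sum[of \<nu> A "\<lambda>\<mu>. \<Sum>i<d. Poly_Mapping.lookup \<mu> i"]) auto
    finally show ?thesis by (simp add: N_def)
  qed
  define k where "k \<nu> = (\<Sum>i<d. Poly_Mapping.lookup \<nu> i * N ^ i)" for \<nu>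
  have inj: "\<nu> = \<mu>" if "\<nu> \<in> A" "k \<nu> = k \<mu>" for \<nu>
  proof (rule poly_mapping_eqI)
    fix i
    show "Poly_Mapping.lookup \<nu> i = Poly_Mapping.lookup \<mu> i"
    proof (cases "i < d")
      case True
      show ?thesis
        using N[OF that(1)] N[OF \<mu>(1)] that(2)[unfolded k_def] True by (rule base_expansion_inj)
    next
      case False
      then have "i \<notin> Poly_Mapping.keys \<nu>" "i \<notin> Poly_Mapping.keys \<mu>"
        using A(2)[OF that(1)] A(2)[OF \<mu>(1)] by auto
      then show ?thesis by (simp add: in_keys_iff)
    qed
  qed
  define P where "P = (\<Sum>\<nu>\<in>A. monom (c \<nu>) (k \<nu>))"
  have "coeff P (k \<mu>) = (\<Sum>\<nu>\<in>A. if \<nu> = \<mu> then c \<mu> else 0)"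
    unfolding P_def coeff_sum by (intro sum.cong refl) (auto dest: inj)
  also have "\<dots> = c \<mu>" using A \<mu> by simp
  finally have "P \<noteq> 0" using \<mu>(2) by auto
  then have fin: "finite {t. poly P t = 0}" by (rule poly_roots_finite)
  have "infinite (range (of_int :: int \<Rightarrow> 'a))"
    by (simp add: finite_image_iff inj_on_def infinite_UNIV_int)
  then obtain T where T: "poly P (of_int T) \<noteq> 0"
    using finite_subset[OF _ fin] by (metis (mono_tags, lifting) image_subsetI mem_Collect_eq)
  have val: "monom_eval \<nu> (\<lambda>i. of_int (T ^ N ^ i)) = (of_int T :: 'a) ^ k \<nu>" if "\<nu> \<in> A" for \<nu>
  proof -
    have "monom_eval \<nu> (\<lambda>i. of_int (T ^ N ^ i)) = (\<Prod>i<d. (of_int (T ^ N ^ i) :: 'a) ^ Poly_Mapping.lookup \<nu> i)"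
      using A(2)[OF that] by (intro monom_eval_superset) auto
    also have "\<dots> = (of_int T :: 'a) ^ k \<nu>"
      unfolding k_def power_sum by (simp add: power_mult[symmetric] mult.commute)
    finally show ?thesis .
  qed
  have "(\<Sum>\<mu>\<in>A. c \<mu> * monom_eval \<mu> (\<lambda>i. of_int (T ^ N ^ i))) = poly P (of_int T)"
    unfolding P_def poly_sum by (intro sum.cong refl) (simp only: val poly_monom)
  then show thesis using T by (intro that[of "\<lambda>i. T ^ N ^ i"]) (simp only: not_False_eq_True)
qed

lemma exists_nonzero_eval:
  fixes p :: "'a::{idom,ring_char_0} mpoly"
  assumes "p \<in> mpoly_ring d" "p \<noteq> 0"
  obtains y :: "nat \<Rightarrow> int" where "mpoly_eval p (\<lambda>i. of_int (y i)) \<noteq> 0"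
proof -
  obtain \<mu> where "\<mu> \<in> Poly_Mapping.keys p" using assms(2) by (metis keys_eq_empty ex_in_conv)
  then show thesis
    using assms(1) exists_nonzero_value[of "Poly_Mapping.keys p" d \<mu> "Poly_Mapping.lookup p"] that
    unfolding mpoly_ring_def mpoly_eval_def by (auto simp: in_keys_iff)
qed

section \<open>Expansion along a line\<close>

text \<open>The expansion of f(x + tb) in powers of t. The ring is arbitrary so that x may be an
  integral point or the tuple of variables itself; the coefficients in the second case specialise to
  those in the first.\<close>

definition line_expand :: "int mpoly \<Rightarrow> (nat \<Rightarrow> 'a::comm_ring_1) \<Rightarrow> (nat \<Rightarrow> 'a) \<Rightarrow> 'a poly" where
  "line_expand f x b = (\<Sum>\<mu>\<in>Poly_Mapping.keys f.
     of_int (Poly_Mapping.lookup f \<mu>) * monom_eval \<mu> (\<lambda>i. [:x i, b i:]))"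

lemma poly_line_expand:
  "poly (line_expand f x b) t =
     (\<Sum>\<mu>\<in>Poly_Mapping.keys f. of_int (Poly_Mapping.lookup f \<mu>) * monom_eval \<mu> (\<lambda>i. x i + t * b i))"
  by (simp add: line_expand_def poly_sum poly_prod)

lemma coeff_line_expand_hom:
  assumes "comm_ring_hom \<phi>"
  shows "coeff (line_expand f (\<lambda>i. \<phi> (x i)) (\<lambda>i. \<phi> (b i))) j = \<phi> (coeff (line_expand f x b) j)"
proof -
  interpret \<phi>: comm_ring_hom \<phi> by fact
  interpret map_poly_comm_ring_hom \<phi> ..
  have "map_poly \<phi> (line_expand f x b) = line_expand f (\<lambda>i. \<phi> (x i)) (\<lambda>i. \<phi> (b i))"
    unfolding line_expand_def by (simp add: hom_distribs)
  then have "coeff (line_expand f (\<lambda>i. \<phi> (x i)) (\<lambda>i. \<phi> (b i))) j = coeff (map_poly \<phi> (line_expand f x b)) j"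
    by (simp only:)
  also have "\<dots> = \<phi> (coeff (line_expand f x b) j)" by (rule coeff_map_poly) (rule \<phi>.hom_zero)
  finally show ?thesis .
qed

text \<open>Stated for degree bounds instead of degrees, since the factors met later may have
  vanishing top coefficients, for instance where b has a zero coordinate.\<close>

lemma coeff_mult_le_degrees:
  fixes p q :: "'a::comm_semiring_0 poly"
  assumes p: "degree p \<le> m" and q: "degree q \<le> n"
  shows "coeff (p * q) (m + n) = coeff p m * coeff q n"
proof -
  have "coeff (p * q) (m + n) = (\<Sum>i\<le>m + n. coeff p i * coeff q (m + n - i))" by (rule coeff_mult)
  also have "\<dots> = (\<Sum>i\<in>{m}. coeff p i * coeff q (m + n - i))"
  proof (rule sum.mono_neutral_right)
    show "\<forall>i\<in>{..m + n} - {m}. coeff p i * coeff q (m + n - i) = 0"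
    proof
      fix i assume i: "i \<in> {..m + n} - {m}"
      show "coeff p i * coeff q (m + n - i) = 0"
      proof (cases "i < m")
        case True
        then have "degree q < m + n - i" using q by linarith
        then show ?thesis by (simp add: coeff_eq_0)
      next
        case False
        then have "degree p < i" using p i by auto
        then show ?thesis by (simp add: coeff_eq_0)
      qed
    qed
  qed auto
  finally show ?thesis by simp
qed

lemma linear_power_top:
  fixes x b :: "'a::comm_ring_1"
  shows "degree ([:x, b:] ^ e) \<le> e \<and> coeff ([:x, b:] ^ e) e = b ^ e"
proof (induction e)
  case (Suc e)
  have "degree [:x, b:] \<le> 1" by simp
  then have "coeff ([:x, b:] * [:x, b:] ^ e) (1 + e) = b * b ^ e"
    using Suc by (subst coeff_mult_le_degrees) auto
  moreover have "degree ([:x, b:] * [:x, b:] ^ e) \<le> 1 + e"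
    using Suc degree_mult_le[of "[:x, b:]" "[:x, b:] ^ e"] \<open>degree [:x, b:] \<le> 1\<close> by linarith
  ultimately show ?case unfolding power_Suc by (simp only: plus_1_eq_Suc)
qed simp

lemma linear_prod_top:
  fixes x b :: "nat \<Rightarrow> 'a::comm_ring_1"
  assumes "finite A"
  shows "degree (\<Prod>i\<in>A. [:x i, b i:] ^ e i) \<le> (\<Sum>i\<in>A. e i) \<and>
    coeff (\<Prod>i\<in>A. [:x i, b i:] ^ e i) (\<Sum>i\<in>A. e i) = (\<Prod>i\<in>A. b i ^ e i)"
  using assms
proof (induction A rule: finite_induct)
  case (insert j A)
  let ?P = "\<Prod>i\<in>A. [:x i, b i:] ^ e i" and ?L = "[:x j, b j:] ^ e j"
  have L: "degree ?L \<le> e j" "coeff ?L (e j) = b j ^ e j" using linear_power_top by blast+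
  have "coeff (?L * ?P) (e j + (\<Sum>i\<in>A. e i)) = b j ^ e j * (\<Prod>i\<in>A. b i ^ e i)"
    using insert.IH L by (subst coeff_mult_le_degrees) auto
  moreover have "degree (?L * ?P) \<le> e j + (\<Sum>i\<in>A. e i)"
    using insert.IH L degree_mult_le[of ?L ?P] by linarith
  ultimately show ?case
    unfolding prod.insert[OF insert.hyps] sum.insert[OF insert.hyps] by blast
qed simp

lemma monom_eval_line_top:
  fixes x b :: "nat \<Rightarrow> 'a::comm_ring_1"
  shows "degree (monom_eval \<mu> (\<lambda>i. [:x i, b i:])) \<le> monom_degree \<mu>"
    and "coeff (monom_eval \<mu> (\<lambda>i. [:x i, b i:])) (monom_degree \<mu>) = monom_eval \<mu> b"
  using linear_prod_top[of "Poly_Mapping.keys \<mu>" x b "Poly_Mapping.lookup \<mu>"]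
  unfolding monom_degree_def by auto

lemma monom_degree_le_total_degree: "\<mu> \<in> Poly_Mapping.keys f \<Longrightarrow> monom_degree \<mu> \<le> total_degree f"
  unfolding total_degree_def by (intro Max_ge) auto

definition top_form :: "int mpoly \<Rightarrow> (nat \<Rightarrow> int) \<Rightarrow> int" where
  "top_form f b = (\<Sum>\<mu>\<in>{\<mu>\<in>Poly_Mapping.keys f. monom_degree \<mu> = total_degree f}.
     Poly_Mapping.lookup f \<mu> * monom_eval \<mu> b)"

lemma coeff_of_int_mult: "coeff (of_int c * p) j = of_int c * coeff p j"
  by (simp add: of_int_poly)

lemma degree_line_expand: "degree (line_expand f x b) \<le> total_degree f"
  unfolding line_expand_def
proof (intro degree_sum_le finite_keys)
  fix \<mu> assume \<mu>: "\<mu> \<in> Poly_Mapping.keys f"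
  have "degree (of_int (Poly_Mapping.lookup f \<mu>) * monom_eval \<mu> (\<lambda>i. [:x i, b i:]))
      \<le> degree (monom_eval \<mu> (\<lambda>i. [:x i, b i:]))"
    by (simp add: of_int_poly degree_smult_le)
  also have "\<dots> \<le> total_degree f"
    using monom_eval_line_top(1) monom_degree_le_total_degree[OF \<mu>] by (rule order_trans)
  finally show "degree (of_int (Poly_Mapping.lookup f \<mu>) * monom_eval \<mu> (\<lambda>i. [:x i, b i:])) \<le> total_degree f" .
qed

text \<open>Only monomials of full degree reach this power of t, and each contributes its value at
  b. The coefficient is therefore common to all lines in direction b.\<close>

lemma top_coeff_line_expand:
  "coeff (line_expand f x (\<lambda>i. of_int (b i))) (total_degree f) = of_int (top_form f b)"
proof -
  let ?m = "total_degree f"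
  have "coeff (line_expand f x (\<lambda>i. of_int (b i))) ?m = (\<Sum>\<mu>\<in>Poly_Mapping.keys f.
      of_int (Poly_Mapping.lookup f \<mu>) * coeff (monom_eval \<mu> (\<lambda>i. [:x i, of_int (b i):])) ?m)"
    unfolding line_expand_def by (simp add: coeff_sum coeff_of_int_mult)
  also have "\<dots> = (\<Sum>\<mu>\<in>Poly_Mapping.keys f. if monom_degree \<mu> = ?m
      then of_int (Poly_Mapping.lookup f \<mu> * monom_eval \<mu> b) else 0)"
  proof (rule sum.cong[OF refl])
    fix \<mu> assume \<mu>: "\<mu> \<in> Poly_Mapping.keys f"
    show "of_int (Poly_Mapping.lookup f \<mu>) * coeff (monom_eval \<mu> (\<lambda>i. [:x i, of_int (b i):])) ?m =
        (if monom_degree \<mu> = ?m then of_int (Poly_Mapping.lookup f \<mu> * monom_eval \<mu> b) else 0)"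
    proof (cases "monom_degree \<mu> = ?m")
      case True
      then show ?thesis
        using monom_eval_line_top(2)[where \<mu> = \<mu> and x = x and b = "\<lambda>i. of_int (b i)"] by simp
    next
      case False
      then have "degree (monom_eval \<mu> (\<lambda>i. [:x i, of_int (b i):])) < ?m"
        using monom_degree_le_total_degree[OF \<mu>] monom_eval_line_top(1)[where \<mu> = \<mu> and x = x and b = "\<lambda>i. of_int (b i)"]
        by linarith
      then show ?thesis using False by (simp add: coeff_eq_0)
    qed
  qed
  also have "\<dots> = of_int (top_form f b)"
    unfolding top_form_def by (simp add: sum.If_cases Int_def)
  finally show ?thesis .
qed

lemma top_form_nonzero:
  assumes f: "f \<in> mpoly_ring d" "f \<noteq> 0"
  obtains b where "top_form f b \<noteq> 0"
proof -
  have "monom_degree ` Poly_Mapping.keys f \<noteq> {}" using f by simp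
  then have "total_degree f \<in> monom_degree ` Poly_Mapping.keys f"
    unfolding total_degree_def using Max_in[of "monom_degree ` Poly_Mapping.keys f"]
    by (subst Max_insert) (auto simp: max_def)
  then obtain \<mu> where \<mu>: "\<mu> \<in> Poly_Mapping.keys f" "monom_degree \<mu> = total_degree f" by auto
  show thesis
  proof (rule exists_nonzero_value)
    let ?A = "{\<mu>\<in>Poly_Mapping.keys f. monom_degree \<mu> = total_degree f}"
    show "finite ?A" by simp
    show "Poly_Mapping.keys \<mu> \<subseteq> {..<d}" if "\<mu> \<in> ?A" for \<mu>
      using f(1) that unfolding mpoly_ring_def by auto
    show "\<mu> \<in> ?A" using \<mu> by simp
    show "Poly_Mapping.lookup f \<mu> \<noteq> 0" using \<mu>(1) by (simp add: in_keys_iff)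
    fix y :: "nat \<Rightarrow> int"
    assume "(\<Sum>\<mu>\<in>?A. Poly_Mapping.lookup f \<mu> * monom_eval \<mu> (\<lambda>i. of_int (y i))) \<noteq> 0"
    then show thesis by (intro that[of y]) (simp add: top_form_def)
  qed
qed

section \<open>Dependence of the line coefficients on the base point\<close>

lemma line_poly_fun_power: "line_poly_fun d D \<phi> \<Longrightarrow> line_poly_fun d (e * D) (\<lambda>x. \<phi> x ^ e)"
  by (induction e) (simp_all add: line_poly_fun_const line_poly_fun_mult)

lemma line_poly_fun_prod:
  assumes "finite A" "\<And>k. k \<in> A \<Longrightarrow> line_poly_fun d (D k) (\<phi> k)"
  shows "line_poly_fun d (\<Sum>k\<in>A. D k) (\<lambda>x. \<Prod>k\<in>A. \<phi> k x)"
  using assms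
  by (induction A rule: finite_induct) (simp_all add: line_poly_fun_const line_poly_fun_mult)

lemma line_poly_fun_monom_eval:
  assumes "Poly_Mapping.keys \<mu> \<subseteq> {..<d}"
  shows "line_poly_fun d (monom_degree \<mu>) (monom_eval \<mu>)"
  unfolding monom_degree_def
proof (rule line_poly_fun_prod)
  fix i assume "i \<in> Poly_Mapping.keys \<mu>"
  then have "line_poly_fun d 1 (\<lambda>x. x i)" using assms by (intro line_poly_fun_coord) auto
  from line_poly_fun_power[OF this, of "Poly_Mapping.lookup \<mu> i"]
  show "line_poly_fun d (Poly_Mapping.lookup \<mu> i) (\<lambda>x. x i ^ Poly_Mapping.lookup \<mu> i)" by simp
qed simp

lemma line_poly_fun_top_form:
  assumes "f \<in> mpoly_ring d"
  shows "line_poly_fun d (total_degree f) (top_form f)"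
  unfolding top_form_def
proof (intro line_poly_fun_sum line_poly_fun_cmult)
  fix \<mu> assume \<mu>: "\<mu> \<in> {\<mu>\<in>Poly_Mapping.keys f. monom_degree \<mu> = total_degree f}"
  then have "Poly_Mapping.keys \<mu> \<subseteq> {..<d}" "monom_degree \<mu> \<le> total_degree f"
    using assms monom_degree_le_total_degree[of \<mu> f] by (auto simp: mpoly_ring_def)
  then show "line_poly_fun d (total_degree f) (monom_eval \<mu>)"
    by (intro line_poly_fun_mono[OF line_poly_fun_monom_eval])
qed

lemma line_poly_fun_mpoly_eval:
  assumes "f \<in> mpoly_ring d"
  shows "line_poly_fun d (total_degree f) (mpoly_eval f)"
  unfolding mpoly_eval_def
proof (intro line_poly_fun_sum line_poly_fun_cmult)
  fix \<mu> assume \<mu>: "\<mu> \<in> Poly_Mapping.keys f"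
  then have "Poly_Mapping.keys \<mu> \<subseteq> {..<d}" "monom_degree \<mu> \<le> total_degree f"
    using assms monom_degree_le_total_degree[of \<mu> f] by (auto simp: mpoly_ring_def)
  then show "line_poly_fun d (total_degree f) (monom_eval \<mu>)"
    by (intro line_poly_fun_mono[OF line_poly_fun_monom_eval])
qed

definition coeffwise_line_poly_fun :: "nat \<Rightarrow> nat \<Rightarrow> ((nat \<Rightarrow> int) \<Rightarrow> int poly) \<Rightarrow> bool" where
  "coeffwise_line_poly_fun d D P \<longleftrightarrow> (\<forall>j. line_poly_fun d D (\<lambda>x. coeff (P x) j))"

lemma coeffwise_line_poly_fun_mult:
  "coeffwise_line_poly_fun d D P \<Longrightarrow> coeffwise_line_poly_fun d E Q \<Longrightarrow>
    coeffwise_line_poly_fun d (D + E) (\<lambda>x. P x * Q x)"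
  unfolding coeffwise_line_poly_fun_def coeff_mult
  by (intro allI line_poly_fun_sum line_poly_fun_mult) auto

lemma coeffwise_line_poly_fun_1: "coeffwise_line_poly_fun d D (\<lambda>x. 1)"
  unfolding coeffwise_line_poly_fun_def by (simp add: line_poly_fun_const)

lemma coeffwise_line_poly_fun_power:
  "coeffwise_line_poly_fun d D P \<Longrightarrow> coeffwise_line_poly_fun d (e * D) (\<lambda>x. P x ^ e)"
  by (induction e) (simp_all add: coeffwise_line_poly_fun_1 coeffwise_line_poly_fun_mult)

lemma coeffwise_line_poly_fun_prod:
  assumes "finite A" "\<And>k. k \<in> A \<Longrightarrow> coeffwise_line_poly_fun d (D k) (P k)"
  shows "coeffwise_line_poly_fun d (\<Sum>k\<in>A. D k) (\<lambda>x. \<Prod>k\<in>A. P k x)"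
  using assms
  by (induction A rule: finite_induct) (simp_all add: coeffwise_line_poly_fun_1 coeffwise_line_poly_fun_mult)

lemma line_poly_fun_coeff_line_expand:
  assumes f: "f \<in> mpoly_ring d"
  shows "line_poly_fun d (total_degree f) (\<lambda>x. coeff (line_expand f x b) j)"
proof -
  have "line_poly_fun d (total_degree f) (\<lambda>x. coeff (monom_eval \<mu> (\<lambda>i. [:x i, b i:])) j)"
    if \<mu>: "\<mu> \<in> Poly_Mapping.keys f" for \<mu>
  proof -
    have "coeffwise_line_poly_fun d (monom_degree \<mu>) (\<lambda>x. monom_eval \<mu> (\<lambda>i. [:x i, b i:]))"
      unfolding monom_degree_def
    proof (rule coeffwise_line_poly_fun_prod)
      fix i assume "i \<in> Poly_Mapping.keys \<mu>"
      then have i: "i < d" using f \<mu> unfolding mpoly_ring_def by auto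
      have "line_poly_fun d 1 (\<lambda>x. coeff [:x i, b i:] j)" for j
        by (cases j) (simp_all add: line_poly_fun_coord[OF i, unfolded One_nat_def] line_poly_fun_const)
      then have "coeffwise_line_poly_fun d 1 (\<lambda>x. [:x i, b i:])"
        unfolding coeffwise_line_poly_fun_def by blast
      from coeffwise_line_poly_fun_power[OF this, of "Poly_Mapping.lookup \<mu> i"]
      show "coeffwise_line_poly_fun d (Poly_Mapping.lookup \<mu> i) (\<lambda>x. [:x i, b i:] ^ Poly_Mapping.lookup \<mu> i)"
        by simp
    qed simp
    then have "line_poly_fun d (monom_degree \<mu>) (\<lambda>x. coeff (monom_eval \<mu> (\<lambda>i. [:x i, b i:])) j)"
      unfolding coeffwise_line_poly_fun_def by blast
    then show ?thesis using monom_degree_le_total_degree[OF \<mu>] by (rule line_poly_fun_mono)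
  qed
  then show ?thesis
    unfolding line_expand_def coeff_sum coeff_of_int_mult
    by (intro line_poly_fun_sum line_poly_fun_cmult) simp
qed

text \<open>The indices j and i - j of each product add up to i, so degree m per unit of index is
  preserved. Since \<open>a\<close> does not vary with x, the powers of 4a cost nothing.\<close>

lemma line_poly_fun_sqrt_rec:
  assumes "\<And>j. line_poly_fun d m (\<lambda>x. q x j)" "0 < i"
  shows "line_poly_fun d (m * i) (\<lambda>x. sqrt_rec a (q x) i)"
  using assms(2)
proof (induction i rule: less_induct)
  case (less i)
  have "line_poly_fun d (m * i) (\<lambda>x. (4 * a) ^ (i - 1) * q x i)"
    using less.prems by (intro line_poly_fun_cmult line_poly_fun_mono[OF assms(1)]) simp
  moreover have "line_poly_fun d (m * i) (\<lambda>x. \<Sum>j\<in>{1..<i}. sqrt_rec a (q x) j * sqrt_rec a (q x) (i - j))"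
  proof (rule line_poly_fun_sum)
    fix j assume j: "j \<in> {1..<i}"
    have "line_poly_fun d (m * j + m * (i - j)) (\<lambda>x. sqrt_rec a (q x) j * sqrt_rec a (q x) (i - j))"
      using j by (intro line_poly_fun_mult less.IH) auto
    moreover have "m * j + m * (i - j) = m * i" using j by (simp add: distrib_left[symmetric])
    ultimately show "line_poly_fun d (m * i) (\<lambda>x. sqrt_rec a (q x) j * sqrt_rec a (q x) (i - j))" by simp
  qed
  ultimately show ?case by (subst sqrt_rec.simps) (rule line_poly_fun_diff)
qed

section \<open>Size of the line coefficients and of the formal root\<close>

lemma coeff_le_poly_1:
  fixes p :: "'a::linordered_idom poly"
  assumes "\<And>j. 0 \<le> coeff p j"
  shows "coeff p j \<le> poly p 1"
proof (cases "j \<le> degree p")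
  case True
  then have "coeff p j \<le> (\<Sum>i\<le>degree p. coeff p i)" using assms by (intro member_le_sum) auto
  then show ?thesis by (simp add: poly_altdef)
next
  case False
  then have "coeff p j = 0" by (simp add: coeff_eq_0)
  then show ?thesis using assms by (simp add: poly_altdef sum_nonneg)
qed

lemma coeff_mult_nonneg:
  fixes p q :: "'a::linordered_idom poly"
  assumes "\<And>j. 0 \<le> coeff p j" "\<And>j. 0 \<le> coeff q j"
  shows "0 \<le> coeff (p * q) j"
  unfolding coeff_mult by (intro sum_nonneg mult_nonneg_nonneg assms)

lemma coeff_power_nonneg:
  fixes p :: "'a::linordered_idom poly"
  assumes "\<And>j. 0 \<le> coeff p j"
  shows "0 \<le> coeff (p ^ n) j"
proof (induction n arbitrary: j)
  case 0
  show ?case by simp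
next
  case (Suc n)
  show ?case unfolding power_Suc by (intro coeff_mult_nonneg assms Suc)
qed

lemma coeff_prod_nonneg:
  fixes p :: "'i \<Rightarrow> 'a::linordered_idom poly"
  assumes "\<And>k j. k \<in> A \<Longrightarrow> 0 \<le> coeff (p k) j"
  shows "0 \<le> coeff (\<Prod>k\<in>A. p k) j"
  using assms
proof (induction A arbitrary: j rule: infinite_finite_induct)
  case (insert k A)
  show ?case unfolding prod.insert[OF insert.hyps] by (intro coeff_mult_nonneg insert) auto
qed simp_all

text \<open>With x and b nonnegative no cancellation occurs: each coefficient is at most the value
  at t = 1, which is the monomial evaluated at x + b.\<close>

lemma coeff_monom_eval_line_bound:
  fixes x b :: "nat \<Rightarrow> int"
  assumes "\<And>i. 0 \<le> x i" "\<And>i. 0 \<le> b i" "\<And>i. x i + b i \<le> W"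
  shows "\<bar>coeff (monom_eval \<mu> (\<lambda>i. [:x i, b i:])) j\<bar> \<le> W ^ monom_degree \<mu>"
proof -
  have lin: "0 \<le> coeff [:x i, b i:] j" for i j
    using assms by (cases j; cases "j - 1") (auto simp: coeff_pCons split: nat.splits)
  have nn: "0 \<le> coeff (monom_eval \<mu> (\<lambda>i. [:x i, b i:])) j" for j
    by (intro coeff_prod_nonneg coeff_power_nonneg lin)
  then have "\<bar>coeff (monom_eval \<mu> (\<lambda>i. [:x i, b i:])) j\<bar> \<le> poly (monom_eval \<mu> (\<lambda>i. [:x i, b i:])) 1"
    using coeff_le_poly_1[OF nn] by (simp only: abs_of_nonneg)
  also have "\<dots> = monom_eval \<mu> (\<lambda>i. x i + b i)" by (simp add: poly_prod)
  also have "\<dots> \<le> (\<Prod>i\<in>Poly_Mapping.keys \<mu>. W ^ Poly_Mapping.lookup \<mu> i)"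
    using assms by (intro prod_mono conjI power_mono zero_le_power add_nonneg_nonneg) auto
  also have "\<dots> = W ^ monom_degree \<mu>" by (simp add: monom_degree_def power_sum)
  finally show ?thesis .
qed

lemma card_keys_le:
  assumes f: "f \<in> mpoly_ring d"
  shows "card (Poly_Mapping.keys f) \<le> (total_degree f + 1) ^ d"
proof -
  let ?g = "\<lambda>\<mu>. restrict (Poly_Mapping.lookup \<mu>) {..<d}"
  let ?V = "{..<d} \<rightarrow>\<^sub>E {..total_degree f}"
  have "inj_on ?g (Poly_Mapping.keys f)"
  proof (rule inj_onI, rule poly_mapping_eqI)
    fix \<mu> \<nu> i
    assume mem: "\<mu> \<in> Poly_Mapping.keys f" "\<nu> \<in> Poly_Mapping.keys f" and eq: "?g \<mu> = ?g \<nu>"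
    show "Poly_Mapping.lookup \<mu> i = Poly_Mapping.lookup \<nu> i"
    proof (cases "i < d")
      case True
      then show ?thesis using fun_cong[OF eq, of i] by simp
    next
      case False
      have "Poly_Mapping.keys \<mu> \<subseteq> {..<d}" "Poly_Mapping.keys \<nu> \<subseteq> {..<d}"
        using f mem unfolding mpoly_ring_def by blast+
      then have "i \<notin> Poly_Mapping.keys \<mu>" "i \<notin> Poly_Mapping.keys \<nu>" using False by auto
      then show ?thesis by (simp add: in_keys_iff)
    qed
  qed
  moreover have "?g ` Poly_Mapping.keys f \<subseteq> ?V"
  proof (rule image_subsetI, unfold restrict_PiE_iff, rule ballI)
    fix \<mu> i assume \<mu>: "\<mu> \<in> Poly_Mapping.keys f"
    have "Poly_Mapping.lookup \<mu> i \<le> monom_degree \<mu>"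
    proof (cases "i \<in> Poly_Mapping.keys \<mu>")
      case True
      then show ?thesis unfolding monom_degree_def by (intro member_le_sum) auto
    next
      case False
      then show ?thesis by (simp add: in_keys_iff)
    qed
    then show "Poly_Mapping.lookup \<mu> i \<in> {..total_degree f}"
      using monom_degree_le_total_degree[OF \<mu>] by simp
  qed
  ultimately have "card (Poly_Mapping.keys f) \<le> card ?V"
    by (rule card_inj_on_le) (intro finite_PiE finite_lessThan finite_atMost)
  then show ?thesis by (simp add: card_PiE)
qed

lemma coeff_line_expand_bound:
  fixes x b :: "nat \<Rightarrow> int"
  assumes f: "f \<in> mpoly_ring d"
    and xb: "\<And>i. 0 \<le> x i" "\<And>i. 0 \<le> b i" "\<And>i. x i + b i \<le> W" and W: "1 \<le> W"
  shows "\<bar>coeff (line_expand f x b) j\<bar> \<le> int ((total_degree f + 1) ^ d) * (height f * W ^ total_degree f)"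
proof -
  have H: "\<bar>Poly_Mapping.lookup f \<mu>\<bar> \<le> height f" if "\<mu> \<in> Poly_Mapping.keys f" for \<mu>
    using that unfolding height_def by (intro Max_ge) auto
  have H0: "0 \<le> height f" unfolding height_def by (intro Max_ge) auto
  have "\<bar>coeff (line_expand f x b) j\<bar> = \<bar>\<Sum>\<mu>\<in>Poly_Mapping.keys f.
      Poly_Mapping.lookup f \<mu> * coeff (monom_eval \<mu> (\<lambda>i. [:x i, b i:])) j\<bar>"
    unfolding line_expand_def by (simp add: coeff_sum coeff_of_int_mult)
  also have "\<dots> \<le> (\<Sum>\<mu>\<in>Poly_Mapping.keys f. \<bar>Poly_Mapping.lookup f \<mu>\<bar> * \<bar>coeff (monom_eval \<mu> (\<lambda>i. [:x i, b i:])) j\<bar>)"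
    unfolding abs_mult[symmetric] by (rule sum_abs)
  also have "\<dots> \<le> (\<Sum>\<mu>\<in>Poly_Mapping.keys f. height f * W ^ total_degree f)"
  proof (intro sum_mono mult_mono H)
    fix \<mu> assume \<mu>: "\<mu> \<in> Poly_Mapping.keys f"
    have "\<bar>coeff (monom_eval \<mu> (\<lambda>i. [:x i, b i:])) j\<bar> \<le> W ^ monom_degree \<mu>"
      using xb by (rule coeff_monom_eval_line_bound)
    also have "\<dots> \<le> W ^ total_degree f"
      using W monom_degree_le_total_degree[OF \<mu>] by (intro power_increasing)
    finally show "\<bar>coeff (monom_eval \<mu> (\<lambda>i. [:x i, b i:])) j\<bar> \<le> W ^ total_degree f" .
  qed (simp_all add: H0)
  also have "\<dots> = int (card (Poly_Mapping.keys f)) * (height f * W ^ total_degree f)" by simp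
  also have "\<dots> \<le> int ((total_degree f + 1) ^ d) * (height f * W ^ total_degree f)"
  proof (rule mult_right_mono)
    show "int (card (Poly_Mapping.keys f)) \<le> int ((total_degree f + 1) ^ d)"
      unfolding of_nat_le_iff by (rule card_keys_le[OF f])
    show "0 \<le> height f * W ^ total_degree f" using H0 W by simp
  qed
  finally show ?thesis .
qed

text \<open>The recursion has weight i, whence the power M^i. \<open>E\<close> is chosen before a, q
  and M, so the constant depends on i alone; its Catalan-type recursion need not be solved.\<close>

lemma sqrt_rec_bound:
  assumes "0 < i"
  shows "\<exists>E::nat. \<forall>(a::int) q M. 1 \<le> M \<longrightarrow> \<bar>4 * a\<bar> \<le> M \<longrightarrow> (\<forall>j. \<bar>q j\<bar> \<le> M) \<longrightarrow>
    \<bar>sqrt_rec a q i\<bar> \<le> int E * M ^ i"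
  using assms
proof (induction i rule: less_induct)
  case (less i)
  let ?P = "\<lambda>i E. \<forall>(a::int) q M. 1 \<le> M \<longrightarrow> \<bar>4 * a\<bar> \<le> M \<longrightarrow> (\<forall>j. \<bar>q j\<bar> \<le> M) \<longrightarrow>
    \<bar>sqrt_rec a q i\<bar> \<le> int E * M ^ i"
  have "\<forall>j\<in>{1..<i}. \<exists>E. ?P j E" using less.IH by simp
  then obtain E where E: "\<And>j. j \<in> {1..<i} \<Longrightarrow> ?P j (E j)" by metis
  have "?P i (1 + (\<Sum>j\<in>{1..<i}. E j * E (i - j)))"
  proof (intro allI impI)
    fix a :: int and q :: "nat \<Rightarrow> int" and M
    assume M: "1 \<le> M" and a: "\<bar>4 * a\<bar> \<le> M" and q: "\<forall>j. \<bar>q j\<bar> \<le> M"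
    have "\<bar>4 * a\<bar> ^ (i - 1) * \<bar>q i\<bar> \<le> M ^ (i - 1) * M"
      using a q M by (intro mult_mono power_mono) auto
    also have "\<dots> = M ^ i" using less.prems by (cases i) simp_all
    finally have 1: "\<bar>(4 * a) ^ (i - 1) * q i\<bar> \<le> M ^ i" by (simp only: abs_mult power_abs)
    have "\<bar>\<Sum>j\<in>{1..<i}. sqrt_rec a q j * sqrt_rec a q (i - j)\<bar>
        \<le> (\<Sum>j\<in>{1..<i}. \<bar>sqrt_rec a q j\<bar> * \<bar>sqrt_rec a q (i - j)\<bar>)"
      unfolding abs_mult[symmetric] by (rule sum_abs)
    also have "\<dots> \<le> (\<Sum>j\<in>{1..<i}. int (E j * E (i - j)) * M ^ i)"
    proof (rule sum_mono)
      fix j assume j: "j \<in> {1..<i}"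
      then have j': "i - j \<in> {1..<i}" by auto
      have "\<bar>sqrt_rec a q j\<bar> \<le> int (E j) * M ^ j" "\<bar>sqrt_rec a q (i - j)\<bar> \<le> int (E (i - j)) * M ^ (i - j)"
        using E[OF j] E[OF j'] M a q by blast+
      then have "\<bar>sqrt_rec a q j\<bar> * \<bar>sqrt_rec a q (i - j)\<bar> \<le> (int (E j) * M ^ j) * (int (E (i - j)) * M ^ (i - j))"
        using M by (intro mult_mono) auto
      also have "\<dots> = int (E j * E (i - j)) * (M ^ j * M ^ (i - j))" by simp
      also have "M ^ j * M ^ (i - j) = M ^ i" using j unfolding power_add[symmetric] by simp
      finally show "\<bar>sqrt_rec a q j\<bar> * \<bar>sqrt_rec a q (i - j)\<bar> \<le> int (E j * E (i - j)) * M ^ i" .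
    qed
    also have "\<dots> = int (\<Sum>j\<in>{1..<i}. E j * E (i - j)) * M ^ i"
      unfolding of_nat_sum sum_distrib_right ..
    finally have 2: "\<bar>\<Sum>j\<in>{1..<i}. sqrt_rec a q j * sqrt_rec a q (i - j)\<bar>
        \<le> int (\<Sum>j\<in>{1..<i}. E j * E (i - j)) * M ^ i" .
    have "\<bar>sqrt_rec a q i\<bar> \<le> M ^ i + int (\<Sum>j\<in>{1..<i}. E j * E (i - j)) * M ^ i"
      by (subst sqrt_rec.simps) (rule order_trans[OF abs_triangle_ineq4 add_mono[OF 1 2]])
    also have "\<dots> = int (1 + (\<Sum>j\<in>{1..<i}. E j * E (i - j))) * M ^ i"
      unfolding of_nat_add of_nat_1 distrib_right by simp
    finally show "\<bar>sqrt_rec a q i\<bar> \<le> int (1 + (\<Sum>j\<in>{1..<i}. E j * E (i - j))) * M ^ i" .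
  qed
  then show ?case by blast
qed

section \<open>A certificate for not being a square\<close>

text \<open>At index 2k every product other than that of j = k contains an entry beyond k, so the
  recursion collapses to its middle term. On a line q(2k) is the coefficient of t^0, the value of f
  at the base point; so f itself is exhibited as a constant times a square, without rebuilding a
  root in t.\<close>

lemma sqrt_rec_terminating:
  assumes k: "0 < k" and zero: "\<And>i. k < i \<Longrightarrow> i \<le> 2 * k \<Longrightarrow> sqrt_rec a q i = 0"
  shows "(4 * a) ^ (2 * k - 1) * q (2 * k) = (sqrt_rec a q k)\<^sup>2"
proof -
  have "0 = (4 * a) ^ (2 * k - 1) * q (2 * k) - (\<Sum>j\<in>{1..<2 * k}. sqrt_rec a q j * sqrt_rec a q (2 * k - j))"
  proof -
    have "sqrt_rec a q (2 * k) = 0" using k by (intro zero) auto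
    then show ?thesis unfolding sqrt_rec.simps[of a q "2 * k"] by (rule sym)
  qed
  also have "(\<Sum>j\<in>{1..<2 * k}. sqrt_rec a q j * sqrt_rec a q (2 * k - j)) =
      (\<Sum>j\<in>{k}. sqrt_rec a q j * sqrt_rec a q (2 * k - j))"
  proof (rule sum.mono_neutral_right)
    show "\<forall>j\<in>{1..<2 * k} - {k}. sqrt_rec a q j * sqrt_rec a q (2 * k - j) = 0"
    proof
      fix j assume j: "j \<in> {1..<2 * k} - {k}"
      show "sqrt_rec a q j * sqrt_rec a q (2 * k - j) = 0"
      proof (cases "k < j")
        case True
        then show ?thesis using zero[of j] j by simp
      next
        case False
        then show ?thesis using zero[of "2 * k - j"] j by auto
      qed
    qed
  qed (use k in auto)
  finally show ?thesis by (simp add: power2_eq_square)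
qed

text \<open>The generic base point. The expansion there has f as its coefficient of t^0, and
  evaluation at y takes it to the expansion at y.\<close>

definition mpoly_var :: "nat \<Rightarrow> rat mpoly" where
  "mpoly_var i = Poly_Mapping.single (Poly_Mapping.single i 1) 1"

lemma mpoly_var_power: "mpoly_var i ^ n = Poly_Mapping.single (Poly_Mapping.single i n) 1"
  by (induction n) (simp_all add: mpoly_var_def mult_single single_add[symmetric])

lemma monom_eval_mpoly_var: "monom_eval \<mu> mpoly_var = Poly_Mapping.single \<mu> 1"
proof -
  have "(\<Prod>i\<in>A. mpoly_var i ^ e i) = Poly_Mapping.single (\<Sum>i\<in>A. Poly_Mapping.single i (e i)) 1"
    if "finite A" for A e
    using that by (induction A rule: finite_induct) (simp_all add: mpoly_var_power mult_single)
  from this[of "Poly_Mapping.keys \<mu>" "Poly_Mapping.lookup \<mu>", OF finite_keys] show ?thesis by (simp only: poly_mapping_sum_singles)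
qed

lemma line_expand_mpoly_var_0: "coeff (line_expand f mpoly_var b) 0 = mpoly_rat f"
proof -
  have "coeff (line_expand f mpoly_var b) 0 = poly (line_expand f mpoly_var b) 0"
    by (rule poly_0_coeff_0[symmetric])
  also have "\<dots> = (\<Sum>\<mu>\<in>Poly_Mapping.keys f. of_int (Poly_Mapping.lookup f \<mu>) * Poly_Mapping.single \<mu> 1)"
    unfolding poly_line_expand by (simp add: monom_eval_mpoly_var)
  also have "\<dots> = (\<Sum>\<mu>\<in>Poly_Mapping.keys f. Poly_Mapping.single \<mu> (of_int (Poly_Mapping.lookup f \<mu>)))"
    by (simp add: single_of_int[symmetric] mult_single del: single_of_int)
  also have "\<dots> = mpoly_rat f"
  proof (rule poly_mapping_eqI)
    fix \<nu>
    show "Poly_Mapping.lookup (\<Sum>\<mu>\<in>Poly_Mapping.keys f. Poly_Mapping.single \<mu> (of_int (Poly_Mapping.lookup f \<mu>))) \<nu>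
      = Poly_Mapping.lookup (mpoly_rat f) \<nu>"
      unfolding mpoly_rat_def
      by (simp add: lookup_sum lookup_single when_def in_keys_iff sum.delta Poly_Mapping.map.rep_eq)
  qed
  finally show ?thesis .
qed

lemma coeff_mult_mpoly_ring:
  fixes P Q :: "'a::comm_ring_1 mpoly poly"
  assumes "\<And>j. coeff P j \<in> mpoly_ring d" "\<And>j. coeff Q j \<in> mpoly_ring d"
  shows "coeff (P * Q) j \<in> mpoly_ring d"
  unfolding coeff_mult by (intro mpoly_ring_sum mpoly_ring_mult assms)

lemma coeff_1_mpoly_ring: "coeff (1 :: 'a::comm_ring_1 mpoly poly) j \<in> mpoly_ring d"
  using mpoly_ring_of_int[of 1 d, where 'a='a] by (simp add: mpoly_ring_0)

lemma coeff_power_mpoly_ring: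
  fixes P :: "'a::comm_ring_1 mpoly poly"
  assumes "\<And>j. coeff P j \<in> mpoly_ring d"
  shows "coeff (P ^ n) j \<in> mpoly_ring d"
proof (induction n arbitrary: j)
  case 0
  show ?case unfolding power_0 by (rule coeff_1_mpoly_ring)
next
  case (Suc n)
  show ?case unfolding power_Suc by (intro coeff_mult_mpoly_ring assms Suc)
qed

lemma coeff_prod_mpoly_ring:
  fixes P :: "'i \<Rightarrow> 'a::comm_ring_1 mpoly poly"
  assumes "\<And>k j. k \<in> A \<Longrightarrow> coeff (P k) j \<in> mpoly_ring d"
  shows "coeff (\<Prod>k\<in>A. P k) j \<in> mpoly_ring d"
  using assms
proof (induction A arbitrary: j rule: infinite_finite_induct)
  case (insert k A)
  show ?case unfolding prod.insert[OF insert.hyps] by (intro coeff_mult_mpoly_ring insert) auto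
next
  case (infinite A)
  show ?case unfolding prod.infinite[OF infinite.hyps] by (rule coeff_1_mpoly_ring)
next
  case empty
  show ?case unfolding prod.empty by (rule coeff_1_mpoly_ring)
qed

lemma coeff_line_expand_mpoly_ring:
  assumes f: "f \<in> mpoly_ring d"
  shows "coeff (line_expand f mpoly_var (\<lambda>i. of_int (b i))) j \<in> mpoly_ring d"
  unfolding line_expand_def coeff_sum coeff_of_int_mult
proof (intro mpoly_ring_sum mpoly_ring_mult mpoly_ring_of_int coeff_prod_mpoly_ring coeff_power_mpoly_ring)
  fix \<mu> i j assume "\<mu> \<in> Poly_Mapping.keys f" "i \<in> Poly_Mapping.keys \<mu>"
  then have "i < d" using f unfolding mpoly_ring_def by auto
  then have "mpoly_var i \<in> mpoly_ring d" unfolding mpoly_var_def by (intro mpoly_ring_single) simp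
  then show "coeff [:mpoly_var i, of_int (b i):] j \<in> mpoly_ring d"
    by (auto simp: coeff_pCons mpoly_ring_of_int mpoly_ring_0 split: nat.split)
qed

lemma sqrt_rec_mpoly_ring:
  fixes q :: "nat \<Rightarrow> 'a::comm_ring_1 mpoly"
  assumes "\<And>j. q j \<in> mpoly_ring d"
  shows "sqrt_rec (of_int a) q i \<in> mpoly_ring d"
proof (induction i rule: less_induct)
  case (less i)
  have "(4 * of_int a) ^ (i - 1) = (of_int ((4 * a) ^ (i - 1)) :: 'a mpoly)" by simp
  then have "(4 * of_int a) ^ (i - 1) \<in> (mpoly_ring d :: 'a mpoly set)"
    by (simp only: mpoly_ring_of_int)
  then show ?case
    by (subst sqrt_rec.simps) (intro mpoly_ring_diff mpoly_ring_mult mpoly_ring_sum assms less; simp)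
qed

lemma total_degree_0_imp_const:
  assumes "total_degree f = 0"
  shows "mpoly_rat f = mpoly_const (of_int (Poly_Mapping.lookup f 0)) * 1\<^sup>2"
proof -
  have zero: "Poly_Mapping.lookup f \<mu> = 0" if "\<mu> \<noteq> 0" for \<mu>
  proof (rule ccontr)
    assume "Poly_Mapping.lookup f \<mu> \<noteq> 0"
    then have "monom_degree \<mu> = 0"
      using assms monom_degree_le_total_degree[of \<mu> f] by (simp add: in_keys_iff)
    then have "\<forall>i. Poly_Mapping.lookup \<mu> i = 0" unfolding monom_degree_def by (auto simp: in_keys_iff)
    then show False using that by (simp add: poly_mapping_eq_iff fun_eq_iff)
  qed
  show ?thesis
  proof (rule poly_mapping_eqI)
    fix \<mu>
    show "Poly_Mapping.lookup (mpoly_rat f) \<mu> =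
        Poly_Mapping.lookup (mpoly_const (of_int (Poly_Mapping.lookup f 0)) * 1\<^sup>2) \<mu>"
      by (cases "\<mu> = 0") (simp_all add: zero mpoly_rat_def mpoly_const_def Poly_Mapping.map.rep_eq
        lookup_single when_def del: single_of_int)
  qed
qed

text \<open>Apply the collapse of \<open>sqrt_rec_terminating\<close> at the generic point: were all
  entries from k + 1 to 2k zero, f would be a constant times the square of the k-th one. Hence some
  entry is a nonzero polynomial in the base point, and it has a nonzero integral value.\<close>

lemma nonsquare_certificate:
  assumes f: "f \<in> mpoly_ring d"
    and nonsq: "\<not> (\<exists>c::rat. \<exists>g\<in>mpoly_ring d. mpoly_rat f = mpoly_const c * g\<^sup>2)"
    and a: "top_form f b \<noteq> 0" and even: "total_degree f = 2 * k"
  obtains i y where "k < i" "i \<le> 2 * k"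
    "sqrt_rec (top_form f b) (\<lambda>j. coeff (line_expand f y b) (2 * k - j)) i \<noteq> 0"
proof -
  have k: "0 < k"
  proof (rule ccontr)
    assume "\<not> 0 < k"
    then have "total_degree f = 0" using even by simp
    moreover have "(1 :: rat mpoly) \<in> mpoly_ring d" using mpoly_ring_of_int[of 1 d] by simp
    ultimately show False using nonsq total_degree_0_imp_const by blast
  qed
  define q where "q j = coeff (line_expand f mpoly_var (\<lambda>i. of_int (b i))) (2 * k - j)" for j
  let ?a = "top_form f b"
  have "\<exists>i. k < i \<and> i \<le> 2 * k \<and> sqrt_rec (of_int ?a) q i \<noteq> 0"
  proof (rule ccontr)
    assume "\<not> (\<exists>i. k < i \<and> i \<le> 2 * k \<and> sqrt_rec (of_int ?a) q i \<noteq> 0)"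
    then have "(4 * of_int ?a) ^ (2 * k - 1) * q (2 * k) = (sqrt_rec (of_int ?a) q k)\<^sup>2"
      by (intro sqrt_rec_terminating k) blast
    moreover have "q (2 * k) = mpoly_rat f" unfolding q_def by (simp add: line_expand_mpoly_var_0)
    ultimately have sq: "(4 * of_int ?a) ^ (2 * k - 1) * mpoly_rat f = (sqrt_rec (of_int ?a) q k)\<^sup>2" by simp
    \<comment> \<open>A nonzero rational, so it can be moved to the other side and becomes the
      constant 1/s in front of the square.\<close>
    define s :: rat where "s = of_int ((4 * ?a) ^ (2 * k - 1))"
    have s: "s \<noteq> 0" using a by (simp add: s_def)
    have "(4 * of_int ?a) ^ (2 * k - 1) = (of_int ((4 * ?a) ^ (2 * k - 1)) :: rat mpoly)" by simp
    also have "\<dots> = mpoly_const s" unfolding s_def mpoly_const_def by (rule single_of_int[symmetric])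
    finally have "mpoly_const s * mpoly_rat f = (sqrt_rec (of_int ?a) q k)\<^sup>2" using sq by simp
    then have "mpoly_const (1 / s) * (mpoly_const s * mpoly_rat f) = mpoly_const (1 / s) * (sqrt_rec (of_int ?a) q k)\<^sup>2"
      by (rule arg_cong)
    moreover have "mpoly_const (1 / s) * mpoly_const s = 1"
      using s by (simp add: mpoly_const_def mult_single)
    ultimately have "mpoly_rat f = mpoly_const (1 / s) * (sqrt_rec (of_int ?a) q k)\<^sup>2"
      by (simp add: mult.assoc[symmetric])
    moreover have "sqrt_rec (of_int ?a) q k \<in> mpoly_ring d"
      by (rule sqrt_rec_mpoly_ring) (simp only: q_def coeff_line_expand_mpoly_ring[OF f])
    ultimately show False using nonsq by blast
  qed
  then obtain i where i: "k < i" "i \<le> 2 * k" "sqrt_rec (of_int ?a) q i \<noteq> 0" by blast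
  have "sqrt_rec (of_int ?a) q i \<in> mpoly_ring d"
    by (rule sqrt_rec_mpoly_ring) (simp only: q_def coeff_line_expand_mpoly_ring[OF f])
  then obtain y where y: "mpoly_eval (sqrt_rec (of_int ?a) q i) (\<lambda>i. of_int (y i)) \<noteq> 0"
    using i(3) by (rule exists_nonzero_eval)
  interpret ev: comm_ring_hom "\<lambda>p :: rat mpoly. mpoly_eval p (\<lambda>i. of_int (y i))"
    by (rule comm_ring_hom_mpoly_eval)
  have var: "mpoly_eval (mpoly_var i) (\<lambda>i. of_int (y i)) = of_int (y i)" for i
    by (simp add: mpoly_var_def mpoly_eval_single)
  have qj: "mpoly_eval (q j) (\<lambda>i. of_int (y i)) = of_int (coeff (line_expand f y b) (2 * k - j))" for j
  proof -
    have "mpoly_eval (q j) (\<lambda>i. of_int (y i)) =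
        coeff (line_expand f (\<lambda>i. of_int (y i) :: rat) (\<lambda>i. of_int (b i))) (2 * k - j)"
      unfolding q_def coeff_line_expand_hom[OF ev.comm_ring_hom_axioms, symmetric]
      by (simp only: var ev.hom_of_int)
    also have "\<dots> = of_int (coeff (line_expand f y b) (2 * k - j))"
      by (rule coeff_line_expand_hom) (rule of_int_hom.comm_ring_hom_axioms)
    finally show ?thesis .
  qed
  have "mpoly_eval (sqrt_rec (of_int ?a) q i) (\<lambda>i. of_int (y i)) =
      sqrt_rec (of_int ?a) (\<lambda>j. of_int (coeff (line_expand f y b) (2 * k - j))) i"
    unfolding sqrt_rec_hom[OF ev.comm_ring_hom_axioms] qj by (simp only: ev.hom_of_int)
  also have "\<dots> = of_int (sqrt_rec ?a (\<lambda>j. coeff (line_expand f y b) (2 * k - j)) i)"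
    by (rule sqrt_rec_hom[symmetric]) (rule of_int_hom.comm_ring_hom_axioms)
  finally have "sqrt_rec ?a (\<lambda>j. coeff (line_expand f y b) (2 * k - j)) i \<noteq> 0" using y by auto
  then show thesis using i by (intro that)
qed

section \<open>Character sums\<close>

lemma Legendre_cong:
  assumes "[a = b] (mod p)"
  shows "Legendre a p = Legendre b p"
proof -
  have "[a = 0] (mod p) \<longleftrightarrow> [b = 0] (mod p)" using assms by (meson cong_sym cong_trans)
  moreover have "QuadRes p a \<longleftrightarrow> QuadRes p b"
    unfolding QuadRes_def using assms by (meson cong_sym cong_trans)
  ultimately show ?thesis unfolding Legendre_def by simp
qed

lemma abs_Legendre_le: "\<bar>Legendre a p\<bar> \<le> 1"
  unfolding Legendre_def by simp

lemma abs_char_sum_le: "\<bar>char_sum d f l\<bar> \<le> int (l ^ d)"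
proof -
  have "\<bar>char_sum d f l\<bar> \<le> (\<Sum>x\<in>residue_box d l. \<bar>kronecker_prime (mpoly_eval f x) l\<bar>)"
    unfolding char_sum_def by (rule sum_abs)
  also have "\<dots> \<le> (\<Sum>x\<in>residue_box d l. 1)"
    by (intro sum_mono) (simp add: kronecker_prime_def abs_Legendre_le)
  also have "\<dots> = int (card (residue_box d l))" by (simp only: sum_constant mult_1_right)
  finally show ?thesis by (simp only: card_residue_box)
qed

lemma powr_nat_minus_half: "0 < l \<Longrightarrow> real l powr (real d - 1 / 2) = real (l ^ d) / sqrt l"
  by (simp add: powr_diff powr_realpow powr_half_sqrt)

text \<open>The quantity estimated is l times the sum, a sum of l^d line sums. Good base points
  contribute at most (15m + 32) sqrt l each; the bad ones number at most m^2 l^d / (l - 1) and cost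
  l each, at most 2 m^2 l^d together. Division by l leaves a multiple of l^(d - 1/2).\<close>

lemma char_sum_bound:
  assumes f: "f \<in> mpoly_ring d" and m: "m = total_degree f" and l: "prime l"
    and a: "\<not> int l dvd 2 * top_form f b"
    and cert: "odd m \<or> (\<exists>i y. i \<le> m \<and> m < 2 * i \<and>
      \<not> int l dvd sqrt_rec (top_form f b) (\<lambda>j. coeff (line_expand f y b) (m - j)) i)"
  shows "\<bar>real_of_int (char_sum d f l)\<bar> \<le> (15 * real m + 32 + 2 * real (m * m)) * real l powr (real d - 1 / 2)"
proof -
  define L where "L x = line_expand f x b" for x
  define \<psi> where "\<psi> x = Legendre (mpoly_eval f x) (int l)" for x
  define c where "c = 15 * real m + 32"
  \<comment> \<open>Excluding 2 makes the Kronecker symbol the Legendre symbol, which is periodic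
    modulo l.\<close>
  have l2: "l \<noteq> 2" using a by auto
  have l0: "0 < l" using l by (rule prime_gt_0_nat)
  have l1: "1 \<le> sqrt l" using l0 by simp
  have L_m: "coeff (L x) m = top_form f b" for x
    using top_coeff_line_expand[of f x b] by (simp add: L_def m)
  have a0: "top_form f b \<noteq> 0" using a by auto
  have deg: "degree (L x) = m" for x
  proof (rule antisym)
    show "degree (L x) \<le> m" unfolding L_def m by (rule degree_line_expand)
    show "m \<le> degree (L x)" using L_m a0 by (intro le_degree) simp
  qed
  have pL: "poly (L x) t = mpoly_eval f (\<lambda>i. t * b i + 1 * x i)" for x t
    unfolding L_def poly_line_expand mpoly_eval_def by (simp add: add.commute)
  have \<psi>_cong: "\<psi> x = \<psi> y" if "\<And>i. i < d \<Longrightarrow> [x i = y i] (mod int l)" for x y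
    unfolding \<psi>_def
    by (rule Legendre_cong, rule line_poly_fun_mod[OF line_poly_fun_mpoly_eval[OF f]], rule that)
  have "int l * char_sum d f l = (\<Sum>t\<in>{0..<int l}. \<Sum>x\<in>residue_box d l. \<psi> x)"
    unfolding char_sum_def \<psi>_def kronecker_prime_def using l2 by simp
  also have "\<dots> = (\<Sum>t\<in>{0..<int l}. \<Sum>x\<in>residue_box d l. \<psi> (\<lambda>i. t * b i + 1 * x i))"
    by (rule sum.cong[OF refl], rule sum_residue_box_affine[symmetric, OF \<psi>_cong _ l0]) auto
  also have "\<dots> = (\<Sum>x\<in>residue_box d l. \<Sum>t\<in>{0..<int l}. Legendre (poly (L x) t) (int l))"
    unfolding \<psi>_def pL[symmetric] by (rule sum.swap)
  finally have S: "int l * char_sum d f l =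
      (\<Sum>x\<in>residue_box d l. \<Sum>t\<in>{0..<int l}. Legendre (poly (L x) t) (int l))" .
  have trivial: "\<bar>real_of_int (\<Sum>t\<in>{0..<int l}. Legendre (poly (L x) t) (int l))\<bar> \<le> real l" for x
  proof -
    have "\<bar>\<Sum>t\<in>{0..<int l}. Legendre (poly (L x) t) (int l)\<bar> \<le> (\<Sum>t\<in>{0..<int l}. 1)"
      by (rule order_trans[OF sum_abs sum_mono]) (rule abs_Legendre_le)
    also have "\<dots> = int l" by simp
    finally have "real_of_int \<bar>\<Sum>t\<in>{0..<int l}. Legendre (poly (L x) t) (int l)\<bar> \<le> real_of_int (int l)"
      by (simp only: of_int_le_iff)
    then show ?thesis by (simp only: of_int_abs of_int_of_nat_eq)
  qed
  \<comment> \<open>\<open>Z\<close> holds the base points whose line carries no certificate modulo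
    l. It is empty in odd degree, and otherwise it is the zero set of the chosen root coefficient, a
    function of degree m i with i at most m.\<close>
  obtain Z where Z: "Z \<subseteq> residue_box d l" "(l - 1) * card Z \<le> m * m * l ^ d"
    and good: "\<And>x. x \<in> residue_box d l - Z \<Longrightarrow>
      \<bar>real_of_int (\<Sum>t\<in>{0..<int l}. Legendre (poly (L x) t) (int l))\<bar> \<le> c * sqrt l"
  proof (cases "odd m")
    case True
    show thesis
    proof (rule that[of "{}"])
      fix x
      show "\<bar>real_of_int (\<Sum>t\<in>{0..<int l}. Legendre (poly (L x) t) (int l))\<bar> \<le> c * sqrt l"
        using legendre_sum_bound_prime[OF l, unfolded legendre_sum_bound_def, rule_format, of "L x"]
          a True unfolding deg L_m c_def by blast
    qed auto
  next
    case False
    then obtain i y where i: "i \<le> m" "m < 2 * i"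
      and y: "\<not> int l dvd sqrt_rec (top_form f b) (\<lambda>j. coeff (L y) (m - j)) i"
      using cert unfolding L_def by blast
    define \<phi> where "\<phi> x = sqrt_rec (top_form f b) (\<lambda>j. coeff (L x) (m - j)) i" for x
    have \<phi>: "line_poly_fun d (m * i) \<phi>"
      unfolding \<phi>_def L_def m
      by (rule line_poly_fun_sqrt_rec) (use i line_poly_fun_coeff_line_expand[OF f] in auto)
    show thesis
    proof (rule that[of "{x\<in>residue_box d l. int l dvd \<phi> x}"])
      have "(l - 1) * card {x\<in>residue_box d l. int l dvd \<phi> x} \<le> m * i * l ^ d"
        using y by (intro card_zeros_mod_prime[OF \<phi> l, of y]) (simp add: \<phi>_def)
      also have "\<dots> \<le> m * m * l ^ d" using i by (intro mult_right_mono mult_left_mono) auto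
      finally show "(l - 1) * card {x\<in>residue_box d l. int l dvd \<phi> x} \<le> m * m * l ^ d" .
    next
      fix x assume "x \<in> residue_box d l - {x\<in>residue_box d l. int l dvd \<phi> x}"
      then have "\<not> int l dvd \<phi> x" by blast
      then show "\<bar>real_of_int (\<Sum>t\<in>{0..<int l}. Legendre (poly (L x) t) (int l))\<bar> \<le> c * sqrt l"
        using legendre_sum_bound_prime[OF l, unfolded legendre_sum_bound_def, rule_format, of "L x"]
          a i unfolding deg L_m c_def \<phi>_def by blast
    qed blast
  qed
  have fin: "finite Z" using Z(1) finite_residue_box by (rule finite_subset)
  have "real l * \<bar>real_of_int (char_sum d f l)\<bar> = \<bar>real_of_int (int l * char_sum d f l)\<bar>"
    by (simp add: abs_mult)
  also have "\<dots> \<le> (\<Sum>x\<in>residue_box d l. \<bar>real_of_int (\<Sum>t\<in>{0..<int l}. Legendre (poly (L x) t) (int l))\<bar>)"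
    unfolding S of_int_sum[of _ "residue_box d l"] by (rule sum_abs)
  also have "\<dots> \<le> (\<Sum>x\<in>residue_box d l. c * sqrt l + (if x \<in> Z then real l else 0))"
  proof (rule sum_mono)
    fix x assume x: "x \<in> residue_box d l"
    have "0 \<le> c * sqrt l" by (simp add: c_def)
    then show "\<bar>real_of_int (\<Sum>t\<in>{0..<int l}. Legendre (poly (L x) t) (int l))\<bar>
        \<le> c * sqrt l + (if x \<in> Z then real l else 0)"
      using trivial[of x] good[of x] x by (cases "x \<in> Z") (simp_all del: of_int_sum)
  qed
  also have "\<dots> = real (l ^ d) * (c * sqrt l) + real (card Z) * real l"
  proof -
    have "residue_box d l \<inter> Z = Z" using Z(1) by blast
    then have "(\<Sum>x\<in>residue_box d l. if x \<in> Z then real l else 0) = real (card Z) * real l"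
      by (simp add: sum.If_cases finite_residue_box Int_def)
    then show ?thesis unfolding sum.distrib by (simp add: card_residue_box)
  qed
  also have "real (card Z) * real l \<le> 2 * real (m * m) * real (l ^ d) * sqrt l"
  proof -
    \<comment> \<open>The passage from l - 1 to l is the source of the factor 2.\<close>
    have "l \<le> 2 * (l - 1)" using prime_ge_2_nat[OF l] by linarith
    then have "card Z * l \<le> card Z * (2 * (l - 1))" by (rule mult_left_mono) simp
    also have "\<dots> \<le> 2 * (m * m * l ^ d)" using Z(2) by (simp add: mult.commute mult.left_commute)
    finally have "real (card Z * l) \<le> real (2 * (m * m * l ^ d))" by (simp only: of_nat_le_iff)
    then have "real (card Z) * real l \<le> 2 * real (m * m) * real (l ^ d) * 1" by simp
    also have "\<dots> \<le> 2 * real (m * m) * real (l ^ d) * sqrt l" using l1 by (intro mult_left_mono) auto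
    finally show ?thesis .
  qed
  finally have "real l * \<bar>real_of_int (char_sum d f l)\<bar> \<le> (c + 2 * real (m * m)) * real (l ^ d) * sqrt l"
    by (simp add: algebra_simps)
  then have "\<bar>real_of_int (char_sum d f l)\<bar> \<le> (c + 2 * real (m * m)) * real (l ^ d) * sqrt l / real l"
    using l0 by (simp add: pos_le_divide_eq mult.commute)
  also have "\<dots> = (c + 2 * real (m * m)) * real (l ^ d) * (sqrt l / real l)" by simp
  also have "sqrt l / real l = inverse (sqrt l)" by (rule sqrt_divide_self_eq) simp
  also have "(c + 2 * real (m * m)) * real (l ^ d) * inverse (sqrt l) =
      (c + 2 * real (m * m)) * (real (l ^ d) / sqrt l)"
    by (simp only: divide_inverse mult.assoc)
  finally show ?thesis unfolding powr_nat_minus_half[OF l0] c_def .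
qed

text \<open>The trivial bound l^d misses the target by sqrt l, which is harmless for bounded
  primes.\<close>

lemma char_sum_trivial_bound:
  assumes "0 < l" "real l \<le> A"
  shows "\<bar>real_of_int (char_sum d f l)\<bar> \<le> sqrt A * real l powr (real d - 1 / 2)"
proof -
  have "\<bar>real_of_int (char_sum d f l)\<bar> \<le> real (l ^ d)"
    using abs_char_sum_le[of d f l] by linarith
  also have "\<dots> = sqrt l * (real (l ^ d) / sqrt l)" using assms by simp
  also have "\<dots> \<le> sqrt A * (real (l ^ d) / sqrt l)"
    using assms by (intro mult_right_mono) auto
  finally show ?thesis unfolding powr_nat_minus_half[OF assms(1)] .
qed

text \<open>With M = G H(f), the factor 2a is at most M and the root coefficient, of weight i at
  most m, is at most F M^m; this gives the exponent m + 1. A constant factor is still allowed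
  here.\<close>

lemma exists_bad_modulus:
  fixes d m :: nat
  obtains A :: nat where "\<And>f. f \<in> mpoly_ring d \<Longrightarrow> total_degree f = m \<Longrightarrow>
    \<not> (\<exists>c::rat. \<exists>g\<in>mpoly_ring d. mpoly_rat f = mpoly_const c * g\<^sup>2) \<Longrightarrow>
    \<exists>B::int. B \<noteq> 0 \<and> \<bar>B\<bar> \<le> int A * height f ^ (m + 1) \<and>
      (\<forall>l. prime l \<longrightarrow> \<not> int l dvd B \<longrightarrow> \<bar>real_of_int (char_sum d f l)\<bar> \<le>
        (15 * real m + 32 + 2 * real (m * m)) * real l powr (real d - 1 / 2))"
proof -
  let ?P = "\<lambda>i E. \<forall>(a::int) q M. 1 \<le> M \<longrightarrow> \<bar>4 * a\<bar> \<le> M \<longrightarrow> (\<forall>j. \<bar>q j\<bar> \<le> M) \<longrightarrow>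
    \<bar>sqrt_rec a q i\<bar> \<le> int E * M ^ i"
  have "\<forall>i\<in>{1..m}. \<exists>E. ?P i E" using sqrt_rec_bound by simp
  then obtain E where E: "\<And>i. i \<in> {1..m} \<Longrightarrow> ?P i (E i)" by metis
  \<comment> \<open>The index i of the certificate depends on f, so F dominates the constants for
    all possible i.\<close>
  define F where "F = Suc (\<Sum>i\<in>{1..m}. E i)"
  \<comment> \<open>The coordinates of y are at most m^2, a bound for the degree of the root
    coefficient, and those of b at most m, the degree of the top form. \<open>W\<close> bounds their
    sums and is positive.\<close>
  define W where "W = m * m + m + 1"
  define G where "G = 4 * ((m + 1) ^ d * W ^ m)"
  have G: "4 \<le> G" unfolding G_def W_def by simp
  show thesis
  proof (rule that[of "F * G ^ (m + 1)"])
    fix f :: "int mpoly"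
    assume f: "f \<in> mpoly_ring d" and m: "total_degree f = m"
      and nonsq: "\<not> (\<exists>c::rat. \<exists>g\<in>mpoly_ring d. mpoly_rat f = mpoly_const c * g\<^sup>2)"
    have f0: "f \<noteq> 0"
    proof
      assume "f = 0"
      then have "mpoly_rat f = mpoly_const 0 * 0\<^sup>2" 
        by (simp add: mpoly_rat_def mpoly_const_def Poly_Mapping.map_eq_zero_iff)
      then show False using nonsq mpoly_ring_0 by blast
    qed
    then obtain \<mu> where \<mu>: "\<mu> \<in> Poly_Mapping.keys f" by (metis keys_eq_empty ex_in_conv)
    have "\<bar>Poly_Mapping.lookup f \<mu>\<bar> \<le> height f" using \<mu> unfolding height_def by (intro Max_ge) auto
    then have H: "1 \<le> height f" using \<mu> by (simp add: in_keys_iff)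
    obtain b0 where "top_form f b0 \<noteq> 0" using f f0 by (rule top_form_nonzero)
    then obtain b where b: "\<And>i. 0 \<le> b i \<and> b i \<le> int m" and a0: "top_form f b \<noteq> 0"
      using line_poly_fun_grid_nonzero[OF line_poly_fun_top_form[OF f]] unfolding m by metis
    define a where "a = top_form f b"
    define M where "M = int G * height f"
    have "1 * 1 \<le> int G * height f" using G H by (intro mult_mono) auto
    then have M: "1 \<le> M" by (simp add: M_def)
    have bound: "4 * \<bar>coeff (line_expand f y b) j\<bar> \<le> M" if "\<And>i. 0 \<le> y i \<and> y i \<le> int (m * m)" for y j
    proof -
      have "\<bar>coeff (line_expand f y b) j\<bar> \<le> int ((total_degree f + 1) ^ d) * (height f * int W ^ total_degree f)"
      proof (rule coeff_line_expand_bound[OF f])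
        fix i show "y i + b i \<le> int W" using that[of i] b[of i] unfolding W_def of_nat_add by linarith
      qed (use that b W_def in auto)
      then show ?thesis unfolding M_def G_def m by (simp add: mult.commute mult.left_commute)
    qed
    \<comment> \<open>As a is a coefficient on the line through the origin, the general coefficient
      bound covers it; the 4 in \<open>G\<close> makes room for the 4a of the recursion.\<close>
    have "coeff (line_expand f (\<lambda>_. 0) b) m = a"
      using top_coeff_line_expand[of f "\<lambda>_. 0 :: int" b] unfolding a_def m by simp
    then have aM: "\<bar>4 * a\<bar> \<le> M" using bound[of "\<lambda>_. 0" m] by (simp add: abs_mult)
    have F1: "1 \<le> int F" unfolding F_def by linarith
    show "\<exists>B::int. B \<noteq> 0 \<and> \<bar>B\<bar> \<le> int (F * G ^ (m + 1)) * height f ^ (m + 1) \<and>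
      (\<forall>l. prime l \<longrightarrow> \<not> int l dvd B \<longrightarrow> \<bar>real_of_int (char_sum d f l)\<bar> \<le>
        (15 * real m + 32 + 2 * real (m * m)) * real l powr (real d - 1 / 2))"
    proof -
      have total: "int (F * G ^ (m + 1)) * height f ^ (m + 1) = M * (int F * M ^ m)"
        by (simp add: M_def power_mult_distrib)
      have pos: "1 \<le> int F * M ^ m"
        using mult_mono[OF F1 one_le_power[OF M]] by simp
      have a2: "\<bar>2 * a\<bar> \<le> M" using aM by (simp add: abs_mult)
      show ?thesis
      proof (cases "odd m")
        case True
        have "\<bar>2 * a\<bar> * 1 \<le> M * (int F * M ^ m)" using a2 pos M by (intro mult_mono) auto
        then show ?thesis
          using True a0 char_sum_bound[OF f m[symmetric]] unfolding total a_def
          by (intro exI[of _ "2 * top_form f b"]) auto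
      next
        case False
        then obtain k where k: "m = 2 * k" by auto
        obtain i y0 where i: "k < i" "i \<le> 2 * k" and
          y0: "sqrt_rec a (\<lambda>j. coeff (line_expand f y0 b) (2 * k - j)) i \<noteq> 0"
          using nonsquare_certificate[OF f nonsq a0, of k] m k unfolding a_def by auto
        define \<phi> where "\<phi> x = sqrt_rec a (\<lambda>j. coeff (line_expand f x b) (m - j)) i" for x
        have "line_poly_fun d (m * i) \<phi>"
          unfolding \<phi>_def m[symmetric]
          by (rule line_poly_fun_sqrt_rec) (use i line_poly_fun_coeff_line_expand[OF f] in auto)
        then have "line_poly_fun d (m * m) \<phi>" using i k by (elim line_poly_fun_mono) simp
        moreover have "\<phi> y0 \<noteq> 0" using y0 unfolding \<phi>_def k .
        ultimately obtain y where y: "\<And>i. 0 \<le> y i \<and> y i \<le> int (m * m)" and \<phi>y: "\<phi> y \<noteq> 0"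
          by (rule line_poly_fun_grid_nonzero) blast
        have im: "i \<in> {1..m}" using i k by auto
        have cj: "\<bar>coeff (line_expand f y b) (m - j)\<bar> \<le> M" for j
        proof -
          have "4 * \<bar>coeff (line_expand f y b) (m - j)\<bar> \<le> M" using y by (rule bound)
          then show ?thesis by linarith
        qed
        have "\<bar>\<phi> y\<bar> \<le> int (E i) * M ^ i"
          unfolding \<phi>_def by (intro E[OF im, rule_format] M aM cj)
        also have "\<dots> \<le> int F * M ^ m"
        proof (intro mult_mono power_increasing M)
          have "E i \<le> (\<Sum>i\<in>{1..m}. E i)" using im by (intro member_le_sum) auto
          then show "int (E i) \<le> int F" unfolding F_def by linarith
        qed (use im M in auto)
        finally have "\<bar>2 * a\<bar> * \<bar>\<phi> y\<bar> \<le> M * (int F * M ^ m)" using a2 M by (intro mult_mono) auto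
        then have size: "\<bar>2 * a * \<phi> y\<bar> \<le> M * (int F * M ^ m)" by (simp only: abs_mult)
        have "\<bar>real_of_int (char_sum d f l)\<bar> \<le>
            (15 * real m + 32 + 2 * real (m * m)) * real l powr (real d - 1 / 2)"
          if l: "prime l" "\<not> int l dvd 2 * a * \<phi> y" for l
        proof (rule char_sum_bound[OF f m[symmetric] l(1)])
          show "\<not> int l dvd 2 * top_form f b" using l(2) unfolding a_def by (metis dvd_mult2)
          have "\<not> int l dvd \<phi> y" using l(2) by (metis dvd_mult)
          then show "odd m \<or> (\<exists>i y. i \<le> m \<and> m < 2 * i \<and>
              \<not> int l dvd sqrt_rec (top_form f b) (\<lambda>j. coeff (line_expand f y b) (m - j)) i)"
            using i k unfolding \<phi>_def a_def by auto
        qed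
        moreover have "2 * a * \<phi> y \<noteq> 0" using a0 \<phi>y unfolding a_def by simp
        ultimately show ?thesis using size unfolding total by blast
      qed
    qed
  qed
qed

theorem theorem6p3:
  fixes d m :: nat
  shows "\<exists>(K::nat) (C::real). \<forall>f\<in>mpoly_ring d.
    total_degree f = m \<longrightarrow>
    \<not> (\<exists>c::rat. \<exists>g\<in>mpoly_ring d. mpoly_rat f = mpoly_const c * g\<^sup>2) \<longrightarrow>
    (\<exists>B::int. 1 \<le> \<bar>B\<bar> \<and> \<bar>B\<bar> \<le> height f ^ K \<and>
      (\<forall>l::nat. prime l \<longrightarrow> \<not> int l dvd B \<longrightarrow>
        \<bar>real_of_int (char_sum d f l)\<bar> \<le> C * real l powr (real d - 1 / 2)))"
proof -
  define c where "c = 15 * real m + 32 + 2 * real (m * m)"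
  obtain A :: nat where A: "\<And>f. f \<in> mpoly_ring d \<Longrightarrow> total_degree f = m \<Longrightarrow>
    \<not> (\<exists>c::rat. \<exists>g\<in>mpoly_ring d. mpoly_rat f = mpoly_const c * g\<^sup>2) \<Longrightarrow>
    \<exists>B::int. B \<noteq> 0 \<and> \<bar>B\<bar> \<le> int A * height f ^ (m + 1) \<and>
      (\<forall>l. prime l \<longrightarrow> \<not> int l dvd B \<longrightarrow>
        \<bar>real_of_int (char_sum d f l)\<bar> \<le> c * real l powr (real d - 1 / 2))"
    unfolding c_def using exists_bad_modulus[of d m] by blast
  show ?thesis
  \<comment> \<open>For height at least 2 the factor A is absorbed by A \<le> 2^A \<le> H^A, hence
    the exponent. For height 1 this is impossible, and sqrt A in the constant covers the primes up
    to A by the trivial bound.\<close>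
  proof (rule exI[of _ "A + (m + 1)"], rule exI[of _ "c + sqrt A"], intro ballI impI)
    fix f :: "int mpoly"
    assume "f \<in> mpoly_ring d" "total_degree f = m"
      "\<not> (\<exists>c::rat. \<exists>g\<in>mpoly_ring d. mpoly_rat f = mpoly_const c * g\<^sup>2)"
    from A[OF this] obtain B :: int where B0: "B \<noteq> 0" and B: "\<bar>B\<bar> \<le> int A * height f ^ (m + 1)"
      and good: "\<And>l. prime l \<Longrightarrow> \<not> int l dvd B \<Longrightarrow>
        \<bar>real_of_int (char_sum d f l)\<bar> \<le> c * real l powr (real d - 1 / 2)" by blast
    let ?C = "c + sqrt A"
    have good': "\<bar>real_of_int (char_sum d f l)\<bar> \<le> ?C * real l powr (real d - 1 / 2)"
      if "prime l" "\<not> int l dvd B" for l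
    proof -
      have "c * real l powr (real d - 1 / 2) \<le> ?C * real l powr (real d - 1 / 2)"
        by (intro mult_right_mono) auto
      then show ?thesis using good[OF that] by linarith
    qed
    have H0: "0 \<le> height f" unfolding height_def by (intro Max_ge) auto
    have "height f \<noteq> 0" using B B0 by auto
    then consider "height f = 1" | "2 \<le> height f" using H0 by linarith
    then show "\<exists>B::int. 1 \<le> \<bar>B\<bar> \<and> \<bar>B\<bar> \<le> height f ^ (A + (m + 1)) \<and>
      (\<forall>l::nat. prime l \<longrightarrow> \<not> int l dvd B \<longrightarrow>
        \<bar>real_of_int (char_sum d f l)\<bar> \<le> ?C * real l powr (real d - 1 / 2))"
    proof cases
      case 1
      \<comment> \<open>Only \<open>B = \<plusminus>1\<close> is admissible, but the bad primes are bounded by \<open>A\<close>.\<close>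
      have "\<bar>real_of_int (char_sum d f l)\<bar> \<le> ?C * real l powr (real d - 1 / 2)" if l: "prime l" for l
      proof (cases "int l dvd B")
        case False
        then show ?thesis using good' l by blast
      next
        case True
        then have "int l \<le> \<bar>B\<bar>" using B0 by (intro zdvd_imp_le) auto
        then have "int l \<le> int A" using B 1 by simp
        then have "real l \<le> real A" by simp
        then have "\<bar>real_of_int (char_sum d f l)\<bar> \<le> sqrt A * real l powr (real d - 1 / 2)"
          using prime_gt_0_nat[OF l] by (intro char_sum_trivial_bound)
        also have "\<dots> \<le> ?C * real l powr (real d - 1 / 2)"
          by (intro mult_right_mono) (auto simp: c_def)
        finally show ?thesis .
      qed
      then show ?thesis by (intro exI[of _ 1]) (simp add: 1)
    next
      case 2
      have "int A \<le> int (2 ^ A)" using less_exp[of A] by (simp only: of_nat_le_iff less_imp_le)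
      also have "\<dots> = 2 ^ A" by simp
      also have "\<dots> \<le> height f ^ A" using 2 by (intro power_mono) auto
      finally have "int A * height f ^ (m + 1) \<le> height f ^ A * height f ^ (m + 1)"
        using H0 by (intro mult_right_mono) auto
      then have "\<bar>B\<bar> \<le> height f ^ (A + (m + 1))" using B unfolding power_add by linarith
      moreover have "1 \<le> \<bar>B\<bar>" using B0 by linarith
      ultimately show ?thesis using good' by blast
    qed
  qed
qed

end
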